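(* Let $L>0$, $d_+>d_-$, and let $(u(x-ct,y),v(x-ct,y))$, with profile $(u,v)\in C^2(\mathfrak D_L)$ and wave speed $c\in\mathbb R$, be an $L$-periodic genuine traveling-wave solution of the $\beta$-plane equation in the band $\mathfrak D_L=\mathbb T_L\times[d_-,d_+]$ with $v=0$ on $y=d_\pm$. (i) If $\beta>0$, then $c$ must fall into one of the following four categories: (1) $c$ is a generalized inflection value of $u$, i.e. $\{\beta-\Delta u=0\}\cap\{u=c\}\neq\emptyset$; (2) $c$ is a critical value of $u$, i.e. $\{\nabla u=0\}\cap\{u=c\}\neq\emptyset$; (3) $c$ is the maximum or the minimum of $u$ on $\mathfrak D_L$, i.e. $c\in\{u_{\max},u_{\min}\}$; (4) $c$ is outside $\mathrm{Ran}(u)=[u_{\min},u_{\max}]$, specifically $c\in[c_\beta^+,u_{\min})$, where $$c_\beta^+=u_{\min}-\frac{\beta(d_+-d_-)^2}{2\pi^2}-\frac{(d_+-d_-)^2}{2\pi^2}\sqrt{\beta^2+\frac{4\pi^2\beta}{(d_+-d_-)^2}(u_{\max}-u_{\min})}\,.$$ (ii) If $\beta=0$, then $c$ must be a generalized inflection value of $u$, i.e. $\{\Delta u=0\}\cap\{u=c\}\neq\emptyset$.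
   Context: $\mathbb T_L=\mathbb R/L\mathbb Z$ and $\mathfrak D_L=\{(x,y):x\in\mathbb T_L,\ y\in[d_-,d_+]\}$. For real constants $f_0$ and $\beta\ge 0$, the $\beta$-plane equation is $$u_t+uu_x+vu_y-(f_0+\beta y)v=-\mathfrak P_x,\quad v_t+uv_x+vv_y+(f_0+\beta y)u=-\mathfrak P_y,\quad u_x+v_y=0$$ on $\mathfrak D_L$, where $(u,v)$ is the velocity and $\mathfrak P$ the pressure, with boundary condition $v=0$ on $y=d_\pm$. A traveling-wave solution of speed $c\in\mathbb R$ is a solution (for some pressure) of the form $(u(x-ct,y),v(x-ct,y))$; $(u,v)\in C^2(\mathfrak D_L)$ means that the profiles are $L$-periodic in the first variable and $C^2$ up to the boundary. It is a shear flow if $v\equiv0$ on $\mathfrak D_L$ (so that $u$ depends only on $y$), and genuine if it is not a shear flow. For $f\in C(\mathfrak D_L)$, $f_{\max}$ and $f_{\min}$ denote the maximum and minimum of $f$ over $\mathfrak D_L$. $\Delta=\partial_x^2+\partial_y^2$. *)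

theory Defs
  imports "HOL-Analysis.Analysis"
begin

(* Functions on T_L x [dm, dp] are represented by functions on the unrolled band
   R x [dm, dp] that are L-periodic in the first variable. *)

definition band :: "real \<Rightarrow> real \<Rightarrow> (real \<times> real) set" where
  "band dm dp = UNIV \<times> {dm..dp}"

definition x_periodic :: "real \<Rightarrow> real \<Rightarrow> real \<Rightarrow> (real \<times> real \<Rightarrow> real) \<Rightarrow> bool" where
  "x_periodic L dm dp f \<longleftrightarrow> (\<forall>x. \<forall>y\<in>{dm..dp}. f (x + L, y) = f (x, y))"

definition pd_x :: "(real \<times> real \<Rightarrow> real) \<Rightarrow> real \<times> real \<Rightarrow> real" where
  "pd_x f p = deriv (\<lambda>s. f (s, snd p)) (fst p)"

(* Taken within [dm, dp], hence one-sided at y = dm and y = dp; values of f outside the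
   band play no role. *)
definition pd_y :: "real \<Rightarrow> real \<Rightarrow> (real \<times> real \<Rightarrow> real) \<Rightarrow> real \<times> real \<Rightarrow> real" where
  "pd_y dm dp f p = vector_derivative (\<lambda>s. f (fst p, s)) (at (snd p) within {dm..dp})"

definition laplacian :: "real \<Rightarrow> real \<Rightarrow> (real \<times> real \<Rightarrow> real) \<Rightarrow> real \<times> real \<Rightarrow> real" where
  "laplacian dm dp f p = pd_x (pd_x f) p + pd_y dm dp (pd_y dm dp f) p"

definition gradient :: "real \<Rightarrow> real \<Rightarrow> (real \<times> real \<Rightarrow> real) \<Rightarrow> real \<times> real \<Rightarrow> real \<times> real" where
  "gradient dm dp f p = (pd_x f p, pd_y dm dp f p)"

(* C^1 and C^2 up to the boundary *)

definition C1_band :: "real \<Rightarrow> real \<Rightarrow> (real \<times> real \<Rightarrow> real) \<Rightarrow> bool" where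
  "C1_band dm dp f \<longleftrightarrow>
     (\<forall>x. \<forall>y\<in>{dm..dp}. (\<lambda>s. f (s, y)) differentiable (at x) \<and>
                        (\<lambda>s. f (x, s)) differentiable (at y within {dm..dp})) \<and>
     continuous_on (band dm dp) f \<and>
     continuous_on (band dm dp) (pd_x f) \<and>
     continuous_on (band dm dp) (pd_y dm dp f)"

definition C2_band :: "real \<Rightarrow> real \<Rightarrow> (real \<times> real \<Rightarrow> real) \<Rightarrow> bool" where
  "C2_band dm dp f \<longleftrightarrow>
     C1_band dm dp f \<and> C1_band dm dp (pd_x f) \<and> C1_band dm dp (pd_y dm dp f)"

(* Classical solutions (U, V, P) of the beta-plane equation; the first argument of each field
   is time. *)
definition beta_plane_solution ::
  "real \<Rightarrow> real \<Rightarrow> real \<Rightarrow> real \<Rightarrow> real \<Rightarrow>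
   (real \<Rightarrow> real \<times> real \<Rightarrow> real) \<Rightarrow> (real \<Rightarrow> real \<times> real \<Rightarrow> real) \<Rightarrow>
   (real \<Rightarrow> real \<times> real \<Rightarrow> real) \<Rightarrow> bool" where
  "beta_plane_solution L dm dp f0 \<beta> U V P \<longleftrightarrow>
     (\<forall>t. x_periodic L dm dp (U t) \<and> x_periodic L dm dp (V t) \<and> x_periodic L dm dp (P t) \<and>
          C1_band dm dp (U t) \<and> C1_band dm dp (V t) \<and> C1_band dm dp (P t)) \<and>
     (\<forall>t x. \<forall>y\<in>{dm..dp}.
        (\<lambda>s. U s (x, y)) differentiable (at t) \<and> (\<lambda>s. V s (x, y)) differentiable (at t) \<and>
        deriv (\<lambda>s. U s (x, y)) t
          + U t (x, y) * pd_x (U t) (x, y) + V t (x, y) * pd_y dm dp (U t) (x, y)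
          - (f0 + \<beta> * y) * V t (x, y) = - pd_x (P t) (x, y) \<and>
        deriv (\<lambda>s. V s (x, y)) t
          + U t (x, y) * pd_x (V t) (x, y) + V t (x, y) * pd_y dm dp (V t) (x, y)
          + (f0 + \<beta> * y) * U t (x, y) = - pd_y dm dp (P t) (x, y) \<and>
        pd_x (U t) (x, y) + pd_y dm dp (V t) (x, y) = 0) \<and>
     (\<forall>t x. V t (x, dm) = 0 \<and> V t (x, dp) = 0)"

definition traveling_wave ::
  "real \<Rightarrow> real \<Rightarrow> real \<Rightarrow> real \<Rightarrow> real \<Rightarrow> real \<Rightarrow>
   (real \<times> real \<Rightarrow> real) \<Rightarrow> (real \<times> real \<Rightarrow> real) \<Rightarrow> bool" where
  "traveling_wave L dm dp f0 \<beta> c u v \<longleftrightarrow>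
     (\<exists>P. beta_plane_solution L dm dp f0 \<beta>
            (\<lambda>t (x, y). u (x - c * t, y)) (\<lambda>t (x, y). v (x - c * t, y)) P)"

definition shear_flow :: "real \<Rightarrow> real \<Rightarrow> (real \<times> real \<Rightarrow> real) \<Rightarrow> bool" where
  "shear_flow dm dp v \<longleftrightarrow> (\<forall>p\<in>band dm dp. v p = 0)"

(* For a continuous periodic f these are the maximum and the minimum over the band, and the
   range of f is the interval between them: see band_range below. *)

definition band_max :: "real \<Rightarrow> real \<Rightarrow> (real \<times> real \<Rightarrow> real) \<Rightarrow> real" where
  "band_max dm dp f = (SUP p\<in>band dm dp. f p)"

definition band_min :: "real \<Rightarrow> real \<Rightarrow> (real \<times> real \<Rightarrow> real) \<Rightarrow> real" where
  "band_min dm dp f = (INF p\<in>band dm dp. f p)"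

definition c_beta_plus :: "real \<Rightarrow> real \<Rightarrow> real \<Rightarrow> (real \<times> real \<Rightarrow> real) \<Rightarrow> real" where
  "c_beta_plus dm dp \<beta> u =
     band_min dm dp u - \<beta> * (dp - dm)\<^sup>2 / (2 * pi\<^sup>2)
       - (dp - dm)\<^sup>2 / (2 * pi\<^sup>2)
         * sqrt (\<beta>\<^sup>2 + 4 * pi\<^sup>2 * \<beta> / (dp - dm)\<^sup>2 * (band_max dm dp u - band_min dm dp u))"

lemma x_periodic_int:
  assumes "x_periodic L dm dp f" "y \<in> {dm..dp}"
  shows "f (x + of_int k * L, y) = f (x, y)"
proof (induction k rule: int_induct[where k = 0])
  case (step1 i)
  have "f (x + of_int i * L + L, y) = f (x + of_int i * L, y)"
    using assms unfolding x_periodic_def by blast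
  then show ?case using step1 by (simp add: algebra_simps)
next
  case (step2 i)
  have "f (x + of_int (i - 1) * L + L, y) = f (x + of_int (i - 1) * L, y)"
    using assms unfolding x_periodic_def by blast
  then show ?case using step2 by (simp add: algebra_simps)
qed simp

lemma band_image_eq:
  assumes "L > 0" and per: "x_periodic L dm dp f"
  shows "f ` band dm dp = f ` ({0..L} \<times> {dm..dp})"
proof
  show "f ` band dm dp \<subseteq> f ` ({0..L} \<times> {dm..dp})"
  proof clarify
    fix x y assume "(x, y) \<in> band dm dp"
    then have y: "y \<in> {dm..dp}" by (simp add: band_def)
    define k where "k = \<lfloor>x / L\<rfloor>"
    have "of_int k \<le> x / L" "x / L < of_int k + 1"
      unfolding k_def by linarith+
    then have "x + of_int (- k) * L \<in> {0..L}"
      using \<open>L > 0\<close> by (simp add: field_simps)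
    moreover have "f (x, y) = f (x + of_int (- k) * L, y)"
      using x_periodic_int[OF per y] by metis
    ultimately show "f (x, y) \<in> f ` ({0..L} \<times> {dm..dp})" using y by blast
  qed
qed (auto simp: band_def)

lemma band_range:
  assumes "L > 0" "dm < dp" "x_periodic L dm dp f" "continuous_on (band dm dp) f"
  shows "f ` band dm dp = {band_min dm dp f..band_max dm dp f}"
    and "band_min dm dp f \<le> band_max dm dp f"
proof -
  have cont: "continuous_on ({0..L} \<times> {dm..dp}) f"
    using assms(4) by (rule continuous_on_subset) (auto simp: band_def)
  have "compact (f ` band dm dp)"
    unfolding band_image_eq[OF assms(1,3)]
    by (intro compact_continuous_image[OF cont] compact_Times compact_Icc)
  moreover have "connected (f ` band dm dp)"
    using assms(4) by (rule connected_continuous_image) (auto simp: band_def intro!: connected_Times)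
  ultimately obtain a b where ab: "f ` band dm dp = {a..b}"
    by (metis connected_compact_interval_1 box_real(2))
  have "f ` band dm dp \<noteq> {}" using assms(2) by (auto simp: band_def)
  then have "a \<le> b" using ab by auto
  then show "f ` band dm dp = {band_min dm dp f..band_max dm dp f}"
    and "band_min dm dp f \<le> band_max dm dp f"
    by (simp_all add: band_min_def band_max_def ab)
qed

end

theory Submission
  imports Defs
begin

text \<open>
  Put \<open>w = u - c\<close>. Taking the curl of the momentum equations and using incompressibility gives
  \<open>w \<Delta>v + (\<beta> - \<Delta>w) v = 0\<close>, that is, \<open>div (w\<^sup>2 \<nabla>\<phi>) = - \<beta> w \<phi>\<close> for \<open>\<phi> = v / w\<close>; each case in which the
  theorem excludes \<open>c\<close> forces \<open>v = 0\<close>.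

  If no zero of \<open>w\<close> is a zero of \<open>\<beta> - \<Delta>w\<close>, then \<open>\<bar>v\<bar> \<le> C \<bar>w\<bar>\<close>, and testing the equation with \<open>\<phi>\<close> on
  \<open>{w < 0}\<close> shows that \<open>\<phi>\<close> is locally constant there and \<open>\<beta> v = 0\<close>. For \<open>\<beta> = 0\<close> the same holds on
  \<open>{w > 0}\<close>; then the convective acceleration vanishes, particles move along straight lines with
  constant velocity, and a particle with \<open>v \<noteq> 0\<close> would reach the boundary. For \<open>\<beta> > 0\<close> and
  \<open>c > u\<^sub>m\<^sub>i\<^sub>n\<close> the set \<open>{w < 0}\<close> is a nonempty union of horizontal lines on which \<open>v = 0\<close>, and \<open>v = 0\<close>
  propagates from line to line by a Carleman estimate, in which the singular potential is controlled
  because \<open>\<nabla>w \<noteq> 0\<close> where \<open>w = 0\<close>. For \<open>c < u\<^sub>m\<^sub>i\<^sub>n\<close> the whole band is tested with \<open>\<phi>\<close>, and the Poincare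
  inequality yields \<open>v = 0\<close> when \<open>c\<close> is below \<open>c\<^sub>\<beta>\<^sup>+\<close>.
\<close>

section \<open>Differentiation and integration on the band\<close>

text \<open>Relational counterparts of \<open>pd_x\<close> and \<open>pd_y\<close>. Passing the
  derivative as an argument lets reflected, negated and quotient functions be treated by derivative
  rules. As with \<open>pd_y\<close>, the derivative in \<open>y\<close> is one-sided at the
  walls.\<close>

definition dx_on :: "real \<Rightarrow> real \<Rightarrow> (real \<times> real \<Rightarrow> real) \<Rightarrow> (real \<times> real \<Rightarrow> real) \<Rightarrow> bool" where
  "dx_on a b f f' \<longleftrightarrow> (\<forall>x. \<forall>y\<in>{a..b}. ((\<lambda>s. f (s, y)) has_real_derivative f' (x, y)) (at x))"

definition dy_on :: "real \<Rightarrow> real \<Rightarrow> (real \<times> real \<Rightarrow> real) \<Rightarrow> (real \<times> real \<Rightarrow> real) \<Rightarrow> bool" where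
  "dy_on a b f f' \<longleftrightarrow>
     (\<forall>x. \<forall>y\<in>{a..b}. ((\<lambda>s. f (x, s)) has_real_derivative f' (x, y)) (at y within {a..b}))"

definition C1_on :: "real \<Rightarrow> real \<Rightarrow> (real \<times> real \<Rightarrow> real) \<Rightarrow> (real \<times> real \<Rightarrow> real) \<Rightarrow>
    (real \<times> real \<Rightarrow> real) \<Rightarrow> bool" where
  "C1_on a b f fx fy \<longleftrightarrow> dx_on a b f fx \<and> dy_on a b f fy \<and>
     continuous_on (band a b) f \<and> continuous_on (band a b) fx \<and> continuous_on (band a b) fy"

lemma mem_band [simp]: "(x, y) \<in> band a b \<longleftrightarrow> a \<le> y \<and> y \<le> b"
  by (simp add: band_def)

lemma cbox_subset_band: "cbox (l, a) (r, b) \<subseteq> band a b"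
  by (auto simp: band_def)

lemma dx_onD:
  assumes "dx_on a b f f'" "y \<in> {a..b}"
  shows "((\<lambda>s. f (s, y)) has_real_derivative f' (x, y)) (at x)"
  using assms by (auto simp: dx_on_def)

lemma dy_onD:
  assumes "dy_on a b f f'" "y \<in> {a..b}"
  shows "((\<lambda>s. f (x, s)) has_real_derivative f' (x, y)) (at y within {a..b})"
  using assms by (auto simp: dy_on_def)

lemma C1_onD:
  assumes "C1_on a b f fx fy"
  shows "dx_on a b f fx" "dy_on a b f fy" "continuous_on (band a b) f"
    "continuous_on (band a b) fx" "continuous_on (band a b) fy"
  using assms by (auto simp: C1_on_def)

lemma dy_on_subset:
  assumes "dy_on a b f f'" "a \<le> a'" "b' \<le> b"
  shows "dy_on a' b' f f'"
  unfolding dy_on_def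
  using assms by (auto intro!: has_field_derivative_subset[OF dy_onD[OF assms(1)]])

lemma dx_on_subset:
  assumes "dx_on a b f f'" "a \<le> a'" "b' \<le> b"
  shows "dx_on a' b' f f'"
  using assms by (auto simp: dx_on_def)

lemma dx_on_unique:
  assumes "dx_on a b f f'" "dx_on a b g g'" "\<And>p. p \<in> band a b \<Longrightarrow> f p = g p" "p \<in> band a b"
  shows "f' p = g' p"
proof -
  obtain x y where p: "p = (x, y)" by force
  have y: "y \<in> {a..b}" using assms(4) by (simp add: p)
  have "(\<lambda>s. f (s, y)) = (\<lambda>s. g (s, y))"
    using assms(3) y by auto
  then have "((\<lambda>s. f (s, y)) has_real_derivative g' (x, y)) (at x)"
    using dx_onD[OF assms(2) y, of x] by simp
  then show ?thesis
    unfolding p by (rule DERIV_unique[OF dx_onD[OF assms(1) y]])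
qed

text \<open>For \<open>a < b\<close> every point of \<open>{a..b}\<close> is a limit point of it,
  which makes the one-sided derivative unique. Agreement of \<open>f\<close> and \<open>g\<close> on
  the band suffices because the derivative is taken within it.\<close>

lemma dy_on_unique:
  assumes "a < b" "dy_on a b f f'" "dy_on a b g g'" "\<And>p. p \<in> band a b \<Longrightarrow> f p = g p" "p \<in> band a b"
  shows "f' p = g' p"
proof -
  obtain x y where p: "p = (x, y)" by force
  have y: "y \<in> {a..b}" using assms(5) by (simp add: p)
  have "((\<lambda>s. f (x, s)) has_real_derivative g' (x, y)) (at y within {a..b})"
    by (rule has_field_derivative_transform_within[OF dy_onD[OF assms(3) y], of 1])
       (use y assms(4) in auto)
  then show ?thesis
    unfolding p
    by (intro vector_derivative_unique_within_closed_interval[of a b y "\<lambda>s. f (x, s)"])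
       (use \<open>a < b\<close> y dy_onD[OF assms(2) y] in \<open>auto simp: has_real_derivative_iff_has_vector_derivative\<close>)
qed

lemma dy_on_mvt:
  assumes f: "dy_on a b f f'" and st: "a \<le> s" "s \<le> t" "t \<le> b"
  shows "\<exists>y\<in>{s..t}. f (x, t) - f (x, s) = f' (x, y) * (t - s)"
  by (rule mvt_very_simple[where f = "\<lambda>s. f (x, s)" and f' = "\<lambda>y. (*) (f' (x, y))"])
     (use st in \<open>auto simp: has_field_derivative_def[symmetric]
        intro!: has_field_derivative_subset[OF dy_onD[OF f]]\<close>)

lemma dx_on_mvt:
  assumes f: "dx_on a b f f'" and st: "s \<le> t" "y \<in> {a..b}"
  shows "\<exists>x\<in>{s..t}. f (t, y) - f (s, y) = f' (x, y) * (t - s)"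
  by (rule mvt_very_simple[where f = "\<lambda>s. f (s, y)" and f' = "\<lambda>x. (*) (f' (x, y))"])
     (use st in \<open>auto simp: has_field_derivative_def[symmetric]
        intro!: has_field_derivative_subset[OF dx_onD[OF f]]\<close>)

lemma C1_band_C1_on:
  assumes "C1_band a b f"
  shows "C1_on a b f (pd_x f) (pd_y a b f)"
  using assms unfolding C1_band_def C1_on_def dx_on_def dy_on_def
  by (auto simp: pd_x_def pd_y_def has_real_derivative_iff_has_vector_derivative
      vector_derivative_works DERIV_deriv_iff_real_differentiable
      simp flip: has_real_derivative_iff_has_vector_derivative)

text \<open>The second difference of \<open>f\<close> over a small rectangle, which may be one-sided at the
  boundary, is the area times a value of either mixed derivative.\<close>

lemma mixed_partials_eq:
  assumes ab: "a < b"
    and f: "dx_on a b f fx" "dy_on a b f fy" "dy_on a b fx fxy" "dx_on a b fy fyx"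
    and cont: "continuous_on (band a b) fxy" "continuous_on (band a b) fyx"
    and p: "p \<in> band a b"
  shows "fxy p = fyx p"
proof (rule ccontr)
  assume ne: "fxy p \<noteq> fyx p"
  define e where "e = \<bar>fxy p - fyx p\<bar> / 2"
  have e: "e > 0" using ne by (simp add: e_def)
  obtain d1 where d1: "d1 > 0" "\<And>q. q \<in> band a b \<Longrightarrow> dist q p < d1 \<Longrightarrow> \<bar>fxy q - fxy p\<bar> < e"
    using cont(1) p e unfolding continuous_on_iff dist_real_def by blast
  obtain d2 where d2: "d2 > 0" "\<And>q. q \<in> band a b \<Longrightarrow> dist q p < d2 \<Longrightarrow> \<bar>fyx q - fyx p\<bar> < e"
    using cont(2) p e unfolding continuous_on_iff dist_real_def by blast
  obtain x y where xy: "p = (x, y)" by force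
  have y: "a \<le> y" "y \<le> b" using p by (auto simp: xy)
  define h where "h = min (min d1 d2) (b - a) / 4"
  have h: "h > 0" "4 * h \<le> d1" "4 * h \<le> d2" "4 * h \<le> b - a"
    using d1(1) d2(1) ab by (auto simp: h_def)
  \<comment> \<open>The square of side \<open>h\<close> lies above \<open>y\<close> if it fits under
    \<open>b\<close>, and otherwise has \<open>y\<close> on its upper edge. Thus it stays in the
    band even when \<open>p\<close> is on a wall.\<close>
  define y1 where "y1 = (if y + h \<le> b then y else y - h)"
  have y1: "a \<le> y1" "y1 + h \<le> b" "y - h \<le> y1" "y1 \<le> y"
    using y h by (auto simp: y1_def)
  have near: "dist (x', y') p < d1" "dist (x', y') p < d2" "(x', y') \<in> band a b"
    if "x' \<in> {x..x + h}" "y' \<in> {y1..y1 + h}" for x' y'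
  proof -
    have "dist (x', y') (x, y) \<le> dist x' x + dist y' y"
      using sqrt_sum_squares_le_sum_abs[of "dist x' x" "dist y' y"] by (simp add: dist_Pair_Pair)
    also have "\<dots> \<le> 2 * h" using that y1 by (auto simp: dist_real_def)
    finally show "dist (x', y') p < d1" "dist (x', y') p < d2" using h by (auto simp: xy)
    show "(x', y') \<in> band a b" using that y1 by auto
  qed
  define D where "D = f (x + h, y1 + h) - f (x, y1 + h) - (f (x + h, y1) - f (x, y1))"
  have Y: "y1 + h \<in> {a..b}" "y1 \<in> {a..b}" using y1 h by auto
  have "dx_on a b (\<lambda>q. f (fst q, y1 + h) - f (fst q, y1))
           (\<lambda>q. fx (fst q, y1 + h) - fx (fst q, y1))"
    unfolding dx_on_def
    by (auto intro!: DERIV_diff dx_onD[OF f(1) Y(1)] dx_onD[OF f(1) Y(2)])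
  from dx_on_mvt[OF this, of x "x + h" y] h y obtain x1 where
    x1: "x1 \<in> {x..x + h}" "D = (fx (x1, y1 + h) - fx (x1, y1)) * h"
    unfolding D_def by auto
  from dy_on_mvt[OF f(3), of y1 "y1 + h" x1] h y1 obtain z1 where
    z1: "z1 \<in> {y1..y1 + h}" "D = fxy (x1, z1) * h * h"
    using x1 by auto
  have "dy_on a b (\<lambda>q. f (x + h, snd q) - f (x, snd q)) (\<lambda>q. fy (x + h, snd q) - fy (x, snd q))"
    unfolding dy_on_def
    by (auto intro!: DERIV_diff dy_onD[OF f(2)])
  from dy_on_mvt[OF this, of y1 "y1 + h" x] h y1 obtain z2 where
    z2: "z2 \<in> {y1..y1 + h}" "D = (fy (x + h, z2) - fy (x, z2)) * h"
    unfolding D_def by (auto simp: algebra_simps)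
  have "z2 \<in> {a..b}" using z2 y1 by auto
  from dx_on_mvt[OF f(4) _ this, of x "x + h"] h obtain x2 where
    x2: "x2 \<in> {x..x + h}" "D = fyx (x2, z2) * h * h"
    using z2 by auto
  have "fxy (x1, z1) = fyx (x2, z2)" using z1(2) x2(2) h by simp
  moreover have "\<bar>fxy (x1, z1) - fxy p\<bar> < e" "\<bar>fyx (x2, z2) - fyx p\<bar> < e"
    using d1(2) d2(2) near x1(1) z1(1) x2(1) z2(1) by auto
  ultimately show False unfolding e_def by argo
qed

section \<open>Integration over one period cell\<close>

text \<open>Fubini is applied in opposite orders to the two terms: integrating \<open>Ax\<close>
  first in \<open>x\<close> gives zero by periodicity, and integrating \<open>By\<close> first in
  \<open>y\<close> leaves the flux through the two walls.\<close>

lemma integral_divergence: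
  assumes "L > 0" "a \<le> b"
    and A: "dx_on a b A Ax" and B: "dy_on a b B By"
    and cont: "continuous_on (band a b) Ax" "continuous_on (band a b) By"
    and per: "\<And>y. y \<in> {a..b} \<Longrightarrow> A (L, y) = A (0, y)"
  shows "integral (cbox (0, a) (L, b)) (\<lambda>p. Ax p + By p)
       = integral {0..L} (\<lambda>x. B (x, b) - B (x, a))"
proof -
  have c: "continuous_on (cbox (0, a) (L, b)) Ax" "continuous_on (cbox (0, a) (L, b)) By"
    using cont cbox_subset_band continuous_on_subset by blast+
  have "integral (cbox (0, a) (L, b)) Ax = integral (cbox 0 L) (\<lambda>x. integral (cbox a b) (\<lambda>y. Ax (x, y)))"
    by (rule integral_prod_continuous[OF c(1)])
  also have "\<dots> = integral (cbox a b) (\<lambda>y. integral (cbox 0 L) (\<lambda>x. Ax (x, y)))"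
    by (rule integral_swap_continuous) (use c(1) in \<open>auto simp: case_prod_unfold\<close>)
  also have "\<dots> = integral (cbox a b) (\<lambda>y. 0)"
  proof (rule integral_cong)
    fix y assume "y \<in> cbox a b"
    then have y: "y \<in> {a..b}" by simp
    have "((\<lambda>x. Ax (x, y)) has_integral (A (L, y) - A (0, y))) {0..L}"
      by (rule fundamental_theorem_of_calculus)
         (use \<open>L > 0\<close> dx_onD[OF A y] in \<open>auto simp flip: has_real_derivative_iff_has_vector_derivative
            intro: has_field_derivative_at_within\<close>)
    then show "integral (cbox 0 L) (\<lambda>x. Ax (x, y)) = 0"
      using per[OF y] by (simp add: integral_unique)
  qed
  finally have 1: "integral (cbox (0, a) (L, b)) Ax = 0" by simp
  have "integral (cbox (0, a) (L, b)) By = integral (cbox 0 L) (\<lambda>x. integral (cbox a b) (\<lambda>y. By (x, y)))"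
    by (rule integral_prod_continuous[OF c(2)])
  also have "\<dots> = integral {0..L} (\<lambda>x. B (x, b) - B (x, a))"
    unfolding box_real
  proof (rule integral_cong)
    fix x
    have "((\<lambda>y. By (x, y)) has_integral (B (x, b) - B (x, a))) {a..b}"
      by (rule fundamental_theorem_of_calculus)
         (use \<open>a \<le> b\<close> dy_onD[OF B] in \<open>auto simp flip: has_real_derivative_iff_has_vector_derivative\<close>)
    then show "integral {a..b} (\<lambda>y. By (x, y)) = B (x, b) - B (x, a)"
      by (rule integral_unique)
  qed
  finally have 2: "integral (cbox (0, a) (L, b)) By = integral {0..L} (\<lambda>x. B (x, b) - B (x, a))" .
  show ?thesis
    using 1 2 c by (simp add: integral_add integrable_continuous)
qed

lemma integral_nonpos_imp_zero:
  assumes "L > 0" "a < b" and h: "continuous_on (cbox (0, a) (L, b)) h"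
    and nn: "\<And>p. p \<in> cbox (0, a) (L, b) \<Longrightarrow> 0 \<le> h p"
    and int: "integral (cbox (0, a) (L, b)) h \<le> (0 :: real)"
    and p: "p \<in> cbox (0 :: real, a :: real) (L, b)"
  shows "h p = 0"
proof (rule has_integral_0_cbox_imp_0[OF h _ _ _ p])
  have "h integrable_on cbox (0, a) (L, b)" by (rule integrable_continuous[OF h])
  moreover have "0 \<le> integral (cbox (0, a) (L, b)) h"
    using nn by (intro integral_nonneg calculation) auto
  ultimately show "(h has_integral 0) (cbox (0, a) (L, b))"
    using int by (metis antisym has_integral_integral)
  show "box (0, a) (L, b) \<noteq> {}"
    using assms(1,2) by (auto simp: box_ne_empty Basis_prod_def)
qed (use nn box_subset_cbox in blast)

lemma bounded_on_box:
  assumes "continuous_on (band a b) f"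
  obtains K where "K \<ge> 0" "\<And>p. p \<in> cbox (l, a) (r, b) \<Longrightarrow> \<bar>f p :: real\<bar> \<le> K"
proof -
  have "compact (f ` cbox (l, a) (r, b))"
    using assms cbox_subset_band continuous_on_subset
    by (intro compact_continuous_image compact_cbox) blast
  then obtain K where "\<forall>z\<in>f ` cbox (l, a) (r, b). norm z \<le> K"
    using compact_imp_bounded bounded_iff by blast
  then have "\<bar>f p\<bar> \<le> max K 0" if "p \<in> cbox (l, a) (r, b)" for p
    using that by (auto simp: le_max_iff_disj)
  then show ?thesis by (intro that[of "max K 0"]) auto
qed

text \<open>Stands for the limit \<open>t\<close> to \<open>0\<close> in the Carleman estimate,
  where \<open>t\<close> regularises the Hardy weight. If \<open>X > R\<close>, the choice
  \<open>t = (X - R) / (N + 1)\<close> is contradictory.\<close>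

lemma le_of_le_add_mult:
  fixes X R N :: real
  assumes "\<And>t. t > 0 \<Longrightarrow> X \<le> N * t + R" "N \<ge> 0"
  shows "X \<le> R"
proof (rule ccontr)
  assume "\<not> X \<le> R"
  then have "X - R > 0" by simp
  then have "X \<le> N * ((X - R) / (N + 1)) + R"
    using assms by (intro assms(1)) auto
  then have "(X - R) * (N + 1) \<le> N * (X - R)"
    using \<open>N \<ge> 0\<close> by (simp add: field_simps)
  with \<open>X - R > 0\<close> show False by (simp add: algebra_simps)
qed

text \<open>Stands for the limit of an infinite Carleman parameter \<open>s\<close>: for
  \<open>I > 0\<close> the left side would grow linearly in \<open>s\<close>. The witness is chosen
  to make it equal to \<open>W + 1\<close>.\<close>

lemma le_zero_of_mult_le:
  fixes I W C :: real
  assumes "\<And>s. s > C \<Longrightarrow> (s - C) / 2 * I \<le> W" "W \<ge> 0"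
  shows "I \<le> 0"
proof (rule ccontr)
  assume "\<not> I \<le> 0"
  then have I: "I > 0" by simp
  have "(C + 2 * (W + 1) / I - C) / 2 * I \<le> W"
    using I assms(2) by (intro assms(1)) auto
  with I show False by simp
qed

section \<open>Unique continuation from a horizontal line\<close>

text \<open>A Carleman estimate with the weight \<open>exp (- s * (y - y0))\<close>: for \<open>g = exp (- s * (y - y0)) * v\<close>
  multiply \<open>exp (- s * (y - y0)) * \<Delta> v\<close> by \<open>g\<^sub>y\<close> and integrate by parts. The singular potential
  is absorbed by Hardy's inequality, whose weight \<open>1 / (y - y0)\<close> is regularised to \<open>1 / (y - y0 + t)\<close>.\<close>

lemma strip_unique_continuation:
  assumes L: "L > 0" and ab: "a < b"
    and v: "C1_on a b v vx vy" "C1_on a b vx vxx vxy" "C1_on a b vy vxy vyy"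
    and per: "\<And>y. y \<in> {a..b} \<Longrightarrow> v (L, y) = v (0, y)" "\<And>y. y \<in> {a..b} \<Longrightarrow> vx (L, y) = vx (0, y)"
      "\<And>y. y \<in> {a..b} \<Longrightarrow> vy (L, y) = vy (0, y)"
    and init: "\<And>x. v (x, a) = 0" "\<And>x. vy (x, a) = 0"
    and C: "C \<ge> 0" "\<And>x y. y \<in> {a..b} \<Longrightarrow> (y - a) * \<bar>vxx (x, y) + vyy (x, y)\<bar> \<le> C * \<bar>v (x, y)\<bar>"
    and p: "p \<in> cbox (0, a) (L, b)"
  shows "v p = 0"
proof -
  note dx = C1_onD(1)[OF v(1)] C1_onD(1)[OF v(2)] C1_onD(1)[OF v(3)]
  note dy = C1_onD(2)[OF v(1)] C1_onD(2)[OF v(2)] C1_onD(2)[OF v(3)]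
  note cont = C1_onD(3-5)[OF v(1)] C1_onD(4-5)[OF v(2)] C1_onD(5)[OF v(3)]
  let ?Q = "cbox (0, a) (L, b)"
  obtain K where K: "K \<ge> 0" "\<And>p. p \<in> ?Q \<Longrightarrow> \<bar>vyy p\<bar> \<le> K"
    using bounded_on_box[OF cont(6)] by metis
  \<comment> \<open>The vanishing Cauchy data at \<open>y = a\<close> give \<open>vy\<close> of
    first order and \<open>v\<close> of second order in \<open>y - a\<close>. Consequently the
    Laplacian is of first order, which controls the regularisation error below.\<close>
  have vy_le: "\<bar>vy (x, y)\<bar> \<le> K * (y - a)" if "(x, y) \<in> ?Q" for x y
  proof -
    from dy_on_mvt[OF dy(3), of a y x] that init(2) obtain z where
      z: "z \<in> {a..y}" "vy (x, y) = vyy (x, z) * (y - a)" by auto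
    moreover have "\<bar>vyy (x, z)\<bar> \<le> K" using K(2) z that by auto
    ultimately show ?thesis by (simp add: abs_mult mult_right_mono)
  qed
  have v_le: "\<bar>v (x, y)\<bar> \<le> K * (y - a) * (y - a)" if "(x, y) \<in> ?Q" for x y
  proof -
    from dy_on_mvt[OF dy(1), of a y x] that init(1) obtain z where
      z: "z \<in> {a..y}" "v (x, y) = vy (x, z) * (y - a)" by auto
    have "\<bar>vy (x, z)\<bar> \<le> K * (z - a)" using z that by (intro vy_le) auto
    also have "\<dots> \<le> K * (y - a)" using z K(1) by (intro mult_left_mono) auto
    finally show ?thesis using z by (simp add: abs_mult mult_right_mono)
  qed
  \<comment> \<open>For \<open>y > a\<close> the factor \<open>y - a\<close> in the hypothesis is
    divided out. At \<open>y = a\<close> that hypothesis is void, and the bound is obtained by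
    continuity.\<close>
  have lap_le: "\<bar>vxx (x, y) + vyy (x, y)\<bar> \<le> C * K * (y - a)" if "(x, y) \<in> ?Q" for x y
  proof -
    have x: "x \<in> {0..L}" and y: "y \<in> closure {a<..b}" using that ab by auto
    show ?thesis
    proof (rule continuous_le_on_closure[OF _ y, where f = "\<lambda>y. \<bar>vxx (x, y) + vyy (x, y)\<bar> - C * K * (y - a)"
          and a = 0, simplified])
      have "continuous_on {a..b} (\<lambda>y. vxx (x, y))" "continuous_on {a..b} (\<lambda>y. vyy (x, y))"
        by (auto intro!: continuous_on_compose2[OF cont(4)] continuous_on_compose2[OF cont(6)]
            continuous_intros)
      then show "continuous_on (closure {a<..b}) (\<lambda>y. \<bar>vxx (x, y) + vyy (x, y)\<bar> - C * K * (y - a))"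
        using ab by (auto intro!: continuous_intros)
      fix z assume z: "a < z \<and> z \<le> b"
      have "(z - a) * \<bar>vxx (x, z) + vyy (x, z)\<bar> \<le> C * \<bar>v (x, z)\<bar>" using C(2) z by auto
      also have "\<dots> \<le> C * (K * (z - a) * (z - a))" using C(1) v_le[of x z] x z by (intro mult_left_mono) auto
      finally have "(z - a) * \<bar>vxx (x, z) + vyy (x, z)\<bar> \<le> (z - a) * (C * K * (z - a))"
        by (simp add: algebra_simps)
      then show "\<bar>vxx (x, z) + vyy (x, z)\<bar> \<le> C * K * (z - a)" using z by simp
    qed
  qed
  have vx0: "vx (x, a) = 0" for x
  proof -
    have "((\<lambda>s. v (s, a)) has_real_derivative 0) (at x)" by (simp add: init)
    then show ?thesis using DERIV_unique dx_onD[OF dx(1)] ab by (metis atLeastAtMost_iff less_imp_le order_refl)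
  qed
  \<comment> \<open>The quotient in Hardy's inequality with the bounded weight
    \<open>1 / (y - a + 1)\<close>. Its square is the quantity to be shown to vanish. Neither
    \<open>I\<close> nor \<open>W\<close> depends on \<open>s\<close>.\<close>
  define z where "z q = v q / (snd q - a + 1)" for q
  have contz: "continuous_on ?Q (\<lambda>q. (z q)\<^sup>2)"
    unfolding z_def using continuous_on_subset[OF cont(1) cbox_subset_band[of 0 a L b]]
    by (auto intro!: continuous_intros)
  define I where "I = integral ?Q (\<lambda>q. (z q)\<^sup>2)"
  define W where "W = integral {0..L} (\<lambda>x. (vx (x, b))\<^sup>2) / 2"
  have contvxb: "continuous_on {0..L} (\<lambda>x. vx (x, b))"
    using ab by (auto intro!: continuous_on_compose2[OF cont(2)] continuous_intros)
  have W: "W \<ge> 0"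
    unfolding W_def by (auto intro!: integral_nonneg integrable_continuous_real continuous_intros contvxb)
  have "(s - C) / 2 * I \<le> W" if s: "s > C" for s
  proof -
    \<comment> \<open>With \<open>g = exp (- s * (y - a)) * v\<close>, the derivative of
      \<open>g\<close> in \<open>y\<close> is \<open>exp (- s * (y - a)) * G\<close>, so
      \<open>E\<close> times a quadratic expression in \<open>v\<close>, \<open>vx\<close> and
      \<open>G\<close> is the same expression in \<open>g\<close> and its derivatives.\<close>
    define E where "E q = exp (- (2 * s * (snd q - a)))" for q :: "real \<times> real"
    define G where "G q = vy q - s * v q" for q
    define k where "k = (s - C) / 2"
    have k: "k > 0" using s by (simp add: k_def)
    have contG: "continuous_on (band a b) G" unfolding G_def by (intro continuous_intros cont)
    obtain M where M: "M \<ge> 0" "\<And>p. p \<in> ?Q \<Longrightarrow> \<bar>G p\<bar> \<le> M"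
      using bounded_on_box[OF contG] by metis
    have E: "0 < E q" "q \<in> ?Q \<Longrightarrow> E q \<le> 1" "q \<in> ?Q \<Longrightarrow> E (0, b) \<le> E q" for q
      using s C(1) by (cases q, auto simp: E_def mult_left_mono)+
    have "k * (E (0, b) * I) \<le> (C * K * M * (L * (b - a))) * t + E (0, b) * W" if t: "t > 0" for t
    proof -
      \<comment> \<open>In terms of \<open>g\<close>, the field is \<open>A = gx * gy\<close> and
        \<open>B = (gy^2 - gx^2 + s^2 * g^2) / 2\<close> plus two Hardy terms. The divergence
        without the Hardy terms is \<open>gy\<close> times the weighted Laplacian of
        \<open>v\<close>, minus \<open>2 * s * gy^2\<close>. The Hardy terms use the weights
        \<open>1 / (y - a + t)\<close>, for the potential, and
        \<open>1 / (y - a + 1)\<close>.\<close>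
      define A where "A q = E q * vx q * G q" for q
      define B where "B q = E q * ((G q)\<^sup>2 - (vx q)\<^sup>2 + s\<^sup>2 * (v q)\<^sup>2) / 2
          + C / 2 * (E q * (v q)\<^sup>2 / (snd q - a + t)) + 2 * k * (E q * (v q)\<^sup>2 / (snd q - a + 1))" for q
      define Ax where "Ax q = E q * (vxx q * G q + vx q * (vxy q - s * vx q))" for q
      define By where "By q = E q * (- s * ((G q)\<^sup>2 - (vx q)\<^sup>2 + s\<^sup>2 * (v q)\<^sup>2) + G q * (vyy q - s * vy q)
            - vx q * vxy q + s\<^sup>2 * v q * vy q)
          + C / 2 * (E q * (2 * (v q / (snd q - a + t)) * G q - (v q / (snd q - a + t))\<^sup>2))
          + 2 * k * (E q * (2 * z q * G q - (z q)\<^sup>2))" for q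
      have dA: "dx_on a b A Ax"
        unfolding dx_on_def A_def Ax_def G_def E_def
        by (auto intro!: derivative_eq_intros dx_onD[OF dx(1)] dx_onD[OF dx(2)] dx_onD[OF dx(3)]
            simp: algebra_simps)
      have dB: "dy_on a b B By"
        unfolding dy_on_def
      proof (intro allI ballI)
        fix x y assume y: "y \<in> {a..b}"
        have pos: "y - a + t \<noteq> 0" "y - a + 1 \<noteq> 0" using y t by auto
        have dE: "((\<lambda>y. E (x, y)) has_real_derivative (- 2 * s * E (x, y))) (at y within {a..b})"
          unfolding E_def by (auto intro!: derivative_eq_intros)
        have dG: "((\<lambda>y. G (x, y)) has_real_derivative (vyy (x, y) - s * vy (x, y))) (at y within {a..b})"
          unfolding G_def by (auto intro!: derivative_eq_intros dy_onD[OF dy(1) y] dy_onD[OF dy(3) y])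
        have dH: "((\<lambda>y. E (x, y) * (v (x, y))\<^sup>2 / (y - a + c)) has_real_derivative
            E (x, y) * (2 * (v (x, y) / (y - a + c)) * G (x, y) - (v (x, y) / (y - a + c))\<^sup>2))
            (at y within {a..b})" if "y - a + c \<noteq> 0" for c
        proof -
          have alg: "((- 2 * s * e * r\<^sup>2 + e * (2 * r * ry)) * d - e * r\<^sup>2) / (d * d)
              = e * (2 * (r / d) * (ry - s * r) - (r / d)\<^sup>2)" if "d \<noteq> 0" for e r ry d :: real
            using that by (simp add: field_simps power2_eq_square)
          have "((\<lambda>y. E (x, y) * (v (x, y))\<^sup>2 / (y - a + c)) has_real_derivative
              ((- 2 * s * E (x, y) * (v (x, y))\<^sup>2 + E (x, y) * (2 * v (x, y) * vy (x, y))) * (y - a + c)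
                - E (x, y) * (v (x, y))\<^sup>2) / ((y - a + c) * (y - a + c))) (at y within {a..b})"
            using that by (auto intro!: derivative_eq_intros dy_onD[OF dy(1) y] dE)
          then show ?thesis using alg[OF that] by (simp add: G_def)
        qed
        show "((\<lambda>y. B (x, y)) has_real_derivative By (x, y)) (at y within {a..b})"
          unfolding B_def By_def z_def fst_conv snd_conv
          by (intro DERIV_add DERIV_cmult dH pos)
             (auto intro!: derivative_eq_intros dy_onD[OF dy(1) y] dy_onD[OF dy(2) y] dE dG,
              simp add: field_simps power2_eq_square)
      qed
      have contE: "continuous_on (band a b) E" unfolding E_def by (intro continuous_intros)
      have nz: "snd q - a + t \<noteq> 0" "snd q - a + 1 \<noteq> 0" if "q \<in> band a b" for q
        using that t by (cases q, auto)+
      have cAx: "continuous_on (band a b) Ax"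
        unfolding Ax_def by (intro continuous_intros contE contG cont)
      have cBy: "continuous_on (band a b) By"
        unfolding By_def z_def using nz by (intro continuous_intros contE contG cont) auto
      have key: "k * E (0, b) * (z q)\<^sup>2 + (Ax q + By q) \<le> C * K * M * t" if q: "q \<in> ?Q" for q
      proof -
        obtain x y where xy: "q = (x, y)" by force
        define z1 where "z1 = v q / (y - a + t)"
        define l where "l = vxx q + vyy q"
        have y: "a \<le> y" "y \<le> b" and T: "y - a + t > 0" using q t by (auto simp: xy)
        \<comment> \<open>The hypothesis bounds \<open>l\<close> with the weight
          \<open>y - a\<close>; the surplus \<open>t * \<bar>l\<bar>\<close> is estimated by
          \<open>lap_le\<close> and leaves an error of order \<open>t\<close>.\<close>
        have "(y - a + t) * \<bar>l\<bar> = (y - a) * \<bar>l\<bar> + t * \<bar>l\<bar>" by (simp add: algebra_simps)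
        also have "\<dots> \<le> C * \<bar>v q\<bar> + t * (C * K * (y - a + t))"
        proof (intro add_mono mult_left_mono)
          show "(y - a) * \<bar>l\<bar> \<le> C * \<bar>v q\<bar>" using C(2)[of y x] y by (simp add: l_def xy)
          have "\<bar>l\<bar> \<le> C * K * (y - a)" using lap_le q by (simp add: l_def xy)
          also have "\<dots> \<le> C * K * (y - a + t)" using C(1) K(1) t by (intro mult_left_mono) auto
          finally show "\<bar>l\<bar> \<le> C * K * (y - a + t)" .
        qed (use t in auto)
        finally have "\<bar>l\<bar> \<le> C * \<bar>z1\<bar> + C * K * t"
          using T by (simp add: z1_def field_simps abs_divide)
        then have "l * G q \<le> (C * \<bar>z1\<bar> + C * K * t) * \<bar>G q\<bar>"
          by (metis abs_ge_self abs_ge_zero abs_mult mult_right_mono order_trans)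
        also have "\<dots> = C * (\<bar>z1\<bar> * \<bar>G q\<bar>) + C * K * t * \<bar>G q\<bar>" by (simp add: algebra_simps)
        also have "\<dots> \<le> C * (2 * (G q)\<^sup>2 + z1\<^sup>2 / 2 - z1 * G q) + C * K * t * M"
        proof (intro add_mono mult_left_mono)
          have "0 \<le> (\<bar>z1\<bar> - 2 * \<bar>G q\<bar>)\<^sup>2" by simp
          moreover have "z1 * G q \<le> \<bar>z1\<bar> * \<bar>G q\<bar>" by (metis abs_ge_self abs_mult)
          ultimately show "\<bar>z1\<bar> * \<bar>G q\<bar> \<le> 2 * (G q)\<^sup>2 + z1\<^sup>2 / 2 - z1 * G q"
            by (simp add: power2_diff)
        qed (use C(1) K(1) t M(2) q in auto)
        finally have lG: "l * G q \<le> C * (2 * (G q)\<^sup>2 + z1\<^sup>2 / 2 - z1 * G q) + C * K * t * M" .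
        have zG: "k * (4 * z q * G q - (z q)\<^sup>2) \<le> k * (4 * (G q)\<^sup>2)"
        proof (rule mult_left_mono)
          have "0 \<le> (z q - 2 * G q)\<^sup>2" by simp
          then show "4 * z q * G q - (z q)\<^sup>2 \<le> 4 * (G q)\<^sup>2" by (simp add: power2_diff)
        qed (use k in simp)
        \<comment> \<open>The available \<open>2 * s * (G q)\<^sup>2\<close> is split: the part
          \<open>2 * C\<close> absorbs the singular potential by \<open>lG\<close>, the part
          \<open>4 * k\<close> pays for the second Hardy term by \<open>zG\<close>, and
          \<open>k * (z q)\<^sup>2\<close> is gained.\<close>
        have s2: "2 * s = 4 * k + 2 * C" by (simp add: k_def field_simps)
        have "k * (z q)\<^sup>2 + (vxx q * G q + vx q * (vxy q - s * vx q))
          + (- s * ((G q)\<^sup>2 - (vx q)\<^sup>2 + s\<^sup>2 * (v q)\<^sup>2) + G q * (vyy q - s * vy q)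
            - vx q * vxy q + s\<^sup>2 * v q * vy q) + C / 2 * (2 * z1 * G q - z1\<^sup>2)
          + 2 * k * (2 * z q * G q - (z q)\<^sup>2)
          = l * G q - 2 * s * (G q)\<^sup>2 + C / 2 * (2 * z1 * G q - z1\<^sup>2) + k * (4 * z q * G q - (z q)\<^sup>2)"
          unfolding l_def G_def by (simp add: algebra_simps power2_eq_square)
        also have "\<dots> \<le> C * K * t * M"
          using lG zG unfolding s2 by (simp add: algebra_simps)
        finally have le: "k * (z q)\<^sup>2 + (vxx q * G q + vx q * (vxy q - s * vx q))
          + (- s * ((G q)\<^sup>2 - (vx q)\<^sup>2 + s\<^sup>2 * (v q)\<^sup>2) + G q * (vyy q - s * vy q)
            - vx q * vxy q + s\<^sup>2 * v q * vy q) + C / 2 * (2 * z1 * G q - z1\<^sup>2)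
          + 2 * k * (2 * z q * G q - (z q)\<^sup>2) \<le> C * K * t * M" (is "?l \<le> _") .
        \<comment> \<open>\<open>E\<close> decreases in \<open>y\<close>, so \<open>E (0, b)\<close>
          is its least value on the cell. The flux through the top carries the same factor, so it
          cancels at the end.\<close>
        have "k * E (0, b) * (z q)\<^sup>2 \<le> k * E q * (z q)\<^sup>2"
          using k E(3)[OF q] by (intro mult_right_mono mult_left_mono) auto
        then have "k * E (0, b) * (z q)\<^sup>2 + (Ax q + By q) \<le> k * E q * (z q)\<^sup>2 + (Ax q + By q)"
          by simp
        also have "\<dots> = E q * ?l"
          unfolding Ax_def By_def z1_def xy fst_conv snd_conv by (simp add: algebra_simps)
        also have "\<dots> \<le> E q * (C * K * t * M)"
          using le E(1)[of q] by (intro mult_left_mono) auto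
        also have "\<dots> \<le> 1 * (C * K * t * M)"
          using E(2)[OF q] C(1) K(1) M(1) t by (intro mult_right_mono) auto
        finally show ?thesis by (simp add: mult_ac)
      qed
      have cz: "continuous_on ?Q (\<lambda>q. k * E (0, b) * (z q)\<^sup>2)" by (intro continuous_intros contz)
      have cAB: "continuous_on ?Q (\<lambda>q. Ax q + By q)"
        by (intro continuous_intros continuous_on_subset[OF cAx cbox_subset_band]
            continuous_on_subset[OF cBy cbox_subset_band])
      have "integral ?Q (\<lambda>q. k * E (0, b) * (z q)\<^sup>2 + (Ax q + By q)) \<le> integral ?Q (\<lambda>q. C * K * M * t)"
        using key by (intro integral_le integrable_continuous continuous_intros cz cAB) auto
      also have "\<dots> = C * K * M * (L * (b - a)) * t"
        using L ab by (simp add: content_Pair)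
      finally have "k * E (0, b) * I + integral ?Q (\<lambda>q. Ax q + By q) \<le> C * K * M * (L * (b - a)) * t"
        using cz cAB by (simp add: integral_add integrable_continuous I_def)
      moreover have "integral ?Q (\<lambda>q. Ax q + By q) = integral {0..L} (\<lambda>x. B (x, b) - B (x, a))"
        using per by (intro integral_divergence[OF L less_imp_le[OF ab] dA dB cAx cBy]) (auto simp: A_def E_def G_def)
      \<comment> \<open>All terms of \<open>B\<close> vanish at \<open>y = a\<close>. At
        \<open>y = b\<close> only the term with \<open>vx\<close> has an unfavourable sign, and it
        accounts for \<open>W\<close>.\<close>
      moreover have "integral {0..L} (\<lambda>x. - (E (0, b) / 2) * (vx (x, b))\<^sup>2)
          \<le> integral {0..L} (\<lambda>x. B (x, b) - B (x, a))"
      proof (intro integral_le integrable_continuous_real continuous_intros contvxb)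
        have cB: "continuous_on (band a b) B"
          unfolding B_def using nz by (intro continuous_intros contE contG cont) auto
        show "continuous_on {0..L} (\<lambda>x. B (x, b))" "continuous_on {0..L} (\<lambda>x. B (x, a))"
          using ab by (auto intro!: continuous_on_compose2[OF cB] continuous_intros)
        fix x
        have "B (x, a) = 0" by (simp add: B_def init vx0 G_def)
        moreover have "0 \<le> E (0, b) * ((G (x, b))\<^sup>2 + s\<^sup>2 * (v (x, b))\<^sup>2) / 2
          + C / 2 * (E (0, b) * (v (x, b))\<^sup>2 / (b - a + t)) + 2 * k * (E (0, b) * (v (x, b))\<^sup>2 / (b - a + 1))"
          using E(1) less_imp_le[OF E(1)] C(1) k t ab by (intro add_nonneg_nonneg) auto
        moreover have "E (x, b) = E (0, b)" by (simp add: E_def)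
        ultimately show "- (E (0, b) / 2) * (vx (x, b))\<^sup>2 \<le> B (x, b) - B (x, a)"
          by (simp add: B_def algebra_simps add_divide_distrib diff_divide_distrib)
      qed
      ultimately show ?thesis by (simp add: W_def mult_ac)
    qed
    then have "k * (E (0, b) * I) \<le> E (0, b) * W"
      by (rule le_of_le_add_mult) (use C(1) K(1) M(1) L ab in auto)
    then show ?thesis
      using E(1)[of "(0, b)"] unfolding k_def[symmetric] by (simp add: mult.left_commute)
  qed
  then have "I \<le> 0" using W by (rule le_zero_of_mult_le)
  then have "(z p)\<^sup>2 = 0"
    unfolding I_def using p by (intro integral_nonpos_imp_zero[OF L ab contz]) auto
  then show ?thesis using p by (cases p) (auto simp: z_def)
qed

section \<open>Energy estimates\<close>

lemma x_periodic_box: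
  assumes "L > 0" "x_periodic L a b f" "p \<in> band a b"
  obtains q where "q \<in> cbox (0, a) (L, b)" "f q = f p"
proof -
  have "f p \<in> f ` ({0..L} \<times> {a..b})"
    using assms(3) unfolding band_image_eq[OF assms(1,2), symmetric] by blast
  then obtain q where "q \<in> {0..L} \<times> {a..b}" "f q = f p" by force
  then show ?thesis by (intro that[of q]) auto
qed

lemma bounded_on_band:
  assumes "L > 0" "x_periodic L a b f" "continuous_on (band a b) f"
  obtains K where "K \<ge> 0" "\<And>p. p \<in> band a b \<Longrightarrow> \<bar>f p\<bar> \<le> K"
proof -
  obtain K where K: "K \<ge> 0" "\<And>p. p \<in> cbox (0, a) (L, b) \<Longrightarrow> \<bar>f p\<bar> \<le> K"
    using bounded_on_box[OF assms(3)] by metis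
  have "\<bar>f p\<bar> \<le> K" if "p \<in> band a b" for p
    using x_periodic_box[OF assms(1,2) that] K(2) by metis
  with K(1) show ?thesis by (rule that)
qed

lemma x_periodic_dx:
  assumes f: "x_periodic L a b f" "dx_on a b f f'"
  shows "x_periodic L a b f'"
  unfolding x_periodic_def
proof (intro allI ballI)
  fix x y assume y: "y \<in> {a..b}"
  have "((\<lambda>s. f (s + L, y)) has_real_derivative f' (x + L, y)) (at x)"
    using dx_onD[OF f(2) y] DERIV_shift[of "\<lambda>s. f (s, y)"] by blast
  moreover have "(\<lambda>s. f (s + L, y)) = (\<lambda>s. f (s, y))"
    using f(1) y by (auto simp: x_periodic_def)
  ultimately show "f' (x + L, y) = f' (x, y)"
    using dx_onD[OF f(2) y, of x] by (auto intro: DERIV_unique)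
qed

lemma x_periodic_dy:
  assumes f: "a < b" "x_periodic L a b f" "dy_on a b f f'"
  shows "x_periodic L a b f'"
  unfolding x_periodic_def
proof (intro allI ballI)
  fix x y assume y: "y \<in> {a..b}"
  have "dy_on a b (\<lambda>p. f (fst p + L, snd p)) (\<lambda>p. f' (fst p + L, snd p))"
    using f(3) by (simp add: dy_on_def)
  moreover have "f (fst p + L, snd p) = f p" if "p \<in> band a b" for p
    using f(2) that by (cases p) (auto simp: x_periodic_def)
  ultimately show "f' (x + L, y) = f' (x, y)"
    using dy_on_unique[OF f(1) _ f(3), of "\<lambda>p. f (fst p + L, snd p)" "\<lambda>p. f' (fst p + L, snd p)" "(x, y)"] y
    by auto
qed

section \<open>Truncation to the negative part\<close>

text \<open>An exponent of at least two makes the power of the negative part differentiable at zero,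
  so test functions can be cut off at the boundary of \<open>{w < 0}\<close> whatever the shape of
  that set.\<close>

lemma DERIV_min_zero_power:
  "((\<lambda>z. min z 0 ^ Suc (Suc k)) has_real_derivative (2 + real k) * min x 0 ^ Suc k) (at x)"
proof -
  consider "x < 0" | "x > 0" | "x = 0" by linarith
  then show ?thesis
  proof cases
    case 1
    have "((\<lambda>z. z ^ Suc (Suc k)) has_real_derivative (2 + real k) * min x 0 ^ Suc k) (at x)"
      using 1 DERIV_pow[of "Suc (Suc k)" x UNIV] by (simp add: min_def)
    then show ?thesis
      by (rule has_field_derivative_transform_within_open[where S = "{..<0}"]) (use 1 in auto)
  next
    case 2
    have "((\<lambda>z. 0) has_real_derivative (2 + real k) * min x 0 ^ Suc k) (at x)"
      using 2 by simp
    then show ?thesis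
      by (rule has_field_derivative_transform_within_open[where S = "{0<..}"]) (use 2 in auto)
  next
    case 3
    have "((\<lambda>h::real. min h 0 ^ Suc (Suc k) / h) \<longlongrightarrow> 0) (at 0)"
    proof (rule Lim_null_comparison)
      show "\<forall>\<^sub>F h in at 0. norm (min h 0 ^ Suc (Suc k) / h) \<le> \<bar>h\<bar> ^ Suc k"
        by (rule always_eventually) (auto simp: min_def abs_mult power_abs)
      show "((\<lambda>h::real. \<bar>h\<bar> ^ Suc k) \<longlongrightarrow> 0) (at 0)"
        by (auto intro!: tendsto_eq_intros)
    qed
    then show ?thesis using 3 by (simp add: DERIV_def)
  qed
qed

text \<open>Multiplies \<open>e \<le> n\<^sup>2 + e\<close> by
  \<open>n ^ 4 \<le> (n\<^sup>2 + e)\<^sup>2\<close>. This uniform bound, with the pointwise limit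
  in the next lemma, gives dominated convergence for the error term in
  \<open>negative_region\<close>.\<close>

lemma power4_le_cube:
  fixes n e :: real
  assumes "e > 0"
  shows "e * n ^ 4 / (n\<^sup>2 + e) ^ 3 \<le> 1"
proof -
  have "e * (n\<^sup>2)\<^sup>2 \<le> (n\<^sup>2 + e) * (n\<^sup>2 + e)\<^sup>2"
    using assms by (intro mult_mono power_mono) auto
  moreover have "(n\<^sup>2 + e) ^ 3 > 0" using assms by (intro zero_less_power add_nonneg_pos) auto
  ultimately show ?thesis by (simp add: power3_eq_cube power2_eq_square power4_eq_xxxx mult_ac)
qed

lemma power4_cube_tendsto:
  fixes n :: real
  shows "(\<lambda>k. inverse (real (Suc k)) * n ^ 4 / (n\<^sup>2 + inverse (real (Suc k))) ^ 3) \<longlonglongrightarrow> 0"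
proof (cases "n = 0")
  case False
  have "(\<lambda>k. inverse (real (Suc k)) * n ^ 4 / (n\<^sup>2 + inverse (real (Suc k))) ^ 3)
      \<longlonglongrightarrow> 0 * n ^ 4 / (n\<^sup>2 + 0) ^ 3"
    using False by (intro tendsto_intros LIMSEQ_inverse_real_of_nat) auto
  then show ?thesis by simp
qed simp

section \<open>Consequences of the vorticity equation\<close>

text \<open>Here \<open>w\<close> stands for \<open>u - c\<close>. Incompressibility is left to a
  later locale: for \<open>\<beta> = 0\<close> the present assumptions survive the change from
  \<open>w\<close> to \<open>- w\<close>, so an estimate on \<open>{w < 0}\<close> also yields one
  on \<open>{w > 0}\<close>.\<close>

locale vorticity_pair =
  fixes L a b \<beta> :: real and w wx wy wxx wxy wyx wyy v vx vy vxx vxy vyy :: "real \<times> real \<Rightarrow> real"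
  assumes L: "L > 0" and ab: "a < b" and \<beta>: "\<beta> \<ge> 0"
    and w: "C1_on a b w wx wy" "C1_on a b wx wxx wxy" "C1_on a b wy wyx wyy"
    and v: "C1_on a b v vx vy" "C1_on a b vx vxx vxy" "C1_on a b vy vxy vyy"
    and wper: "x_periodic L a b w" and vper: "x_periodic L a b v"
    and v_bdry: "\<And>x. v (x, a) = 0" "\<And>x. v (x, b) = 0"
    and vorticity: "\<And>p. p \<in> band a b \<Longrightarrow>
      w p * (vxx p + vyy p) + (\<beta> - (wxx p + wyy p)) * v p = 0"
begin

lemmas wdx = C1_onD(1)[OF w(1)] C1_onD(1)[OF w(2)] C1_onD(1)[OF w(3)]
lemmas wdy = C1_onD(2)[OF w(1)] C1_onD(2)[OF w(2)] C1_onD(2)[OF w(3)]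
lemmas wcont = C1_onD(3-5)[OF w(1)] C1_onD(4-5)[OF w(2)] C1_onD(4-5)[OF w(3)]
lemmas vdx = C1_onD(1)[OF v(1)] C1_onD(1)[OF v(2)] C1_onD(1)[OF v(3)]
lemmas vdy = C1_onD(2)[OF v(1)] C1_onD(2)[OF v(2)] C1_onD(2)[OF v(3)]
lemmas vcont = C1_onD(3-5)[OF v(1)] C1_onD(4-5)[OF v(2)] C1_onD(5)[OF v(3)]

lemmas wper' = wper x_periodic_dx[OF wper wdx(1)] x_periodic_dy[OF ab wper wdy(1)]
lemmas wper'' = x_periodic_dx[OF wper'(2) wdx(2)] x_periodic_dy[OF ab wper'(3) wdy(3)]
lemmas vper' = vper x_periodic_dx[OF vper vdx(1)] x_periodic_dy[OF ab vper vdy(1)]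
lemmas vper'' = x_periodic_dx[OF vper'(2) vdx(2)] x_periodic_dy[OF ab vper'(3) vdy(3)]

lemma periodic_end:
  assumes "y \<in> {a..b}"
  shows "w (L, y) = w (0, y)" "wx (L, y) = wx (0, y)" "wy (L, y) = wy (0, y)"
    "v (L, y) = v (0, y)" "vx (L, y) = vx (0, y)" "vy (L, y) = vy (0, y)"
proof -
  have *: "f (L, y) = f (0, y)" if "x_periodic L a b f" for f
    using that assms unfolding x_periodic_def by (metis add_0)
  show "w (L, y) = w (0, y)" "wx (L, y) = wx (0, y)" "wy (L, y) = wy (0, y)"
    "v (L, y) = v (0, y)" "vx (L, y) = vx (0, y)" "vy (L, y) = vy (0, y)"
    by (rule *; fact wper' vper')+
qed

text \<open>As \<open>w\<close> and \<open>q = \<beta> - \<Delta>w\<close> have no common zero,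
  \<open>g = w\<^sup>2 + q\<^sup>2\<close> has a positive minimum over a period cell. In
  \<open>g * \<bar>v\<bar>\<close> the equation turns \<open>q * v\<close> into
  \<open>- w * \<Delta>v\<close>, so every term contains the factor \<open>w\<close>.\<close>

lemma v_le_w:
  assumes "\<And>p. p \<in> band a b \<Longrightarrow> w p = 0 \<Longrightarrow> \<beta> - (wxx p + wyy p) \<noteq> 0"
  obtains C where "C \<ge> 0" "\<And>p. p \<in> band a b \<Longrightarrow> \<bar>v p\<bar> \<le> C * \<bar>w p\<bar>"
proof -
  define q where "q p = \<beta> - (wxx p + wyy p)" for p
  define g where "g p = (w p)\<^sup>2 + (q p)\<^sup>2" for p
  have contg: "continuous_on (band a b) g"
    unfolding g_def q_def by (intro continuous_intros wcont)
  have gper: "x_periodic L a b g"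
    using wper wper'' by (auto simp: x_periodic_def g_def q_def)
  have "cbox (0, a) (L, b) \<noteq> {}" using L ab by (simp add: cbox_Pair_eq)
  from continuous_attains_inf[OF compact_cbox this continuous_on_subset[OF contg cbox_subset_band]]
  obtain p0 where p0: "p0 \<in> cbox (0, a) (L, b)" "\<And>p. p \<in> cbox (0, a) (L, b) \<Longrightarrow> g p0 \<le> g p"
    by blast
  have gmin: "g p0 \<le> g p" if "p \<in> band a b" for p
    using x_periodic_box[OF L gper that] p0(2) by metis
  have "p0 \<in> band a b" using p0(1) cbox_subset_band by blast
  then have pos: "g p0 > 0"
    using assms[of p0] unfolding g_def q_def by (cases "w p0 = 0") (auto intro: add_pos_nonneg)
  define l where "l p = vxx p + vyy p" for p
  have "x_periodic L a b (\<lambda>p. \<bar>w p\<bar> * \<bar>v p\<bar> + \<bar>q p\<bar> * \<bar>l p\<bar>)"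
    using wper vper wper'' vper'' by (auto simp: x_periodic_def q_def l_def)
  moreover have "continuous_on (band a b) (\<lambda>p. \<bar>w p\<bar> * \<bar>v p\<bar> + \<bar>q p\<bar> * \<bar>l p\<bar>)"
    unfolding q_def l_def by (intro continuous_intros wcont vcont)
  ultimately obtain K where K: "K \<ge> 0" "\<And>p. p \<in> band a b \<Longrightarrow> \<bar>\<bar>w p\<bar> * \<bar>v p\<bar> + \<bar>q p\<bar> * \<bar>l p\<bar>\<bar> \<le> K"
    by (rule bounded_on_band[OF L]) blast
  show ?thesis
  proof (rule that)
    show "K / g p0 \<ge> 0" using K(1) pos by simp
    fix p assume p: "p \<in> band a b"
    have "q p * v p = - (w p * l p)"
      using vorticity[OF p] by (simp add: q_def l_def)
    then have qv: "\<bar>q p\<bar> * \<bar>v p\<bar> = \<bar>w p\<bar> * \<bar>l p\<bar>" by (metis abs_minus_cancel abs_mult)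
    have "g p0 * \<bar>v p\<bar> \<le> g p * \<bar>v p\<bar>" using gmin[OF p] by (simp add: mult_right_mono)
    also have "\<dots> = \<bar>w p\<bar> * (\<bar>w p\<bar> * \<bar>v p\<bar>) + \<bar>q p\<bar> * (\<bar>q p\<bar> * \<bar>v p\<bar>)"
      by (simp add: g_def power2_eq_square algebra_simps)
    also have "\<dots> = \<bar>w p\<bar> * (\<bar>w p\<bar> * \<bar>v p\<bar> + \<bar>q p\<bar> * \<bar>l p\<bar>)"
      unfolding qv by (simp add: algebra_simps)
    also have "\<dots> \<le> \<bar>w p\<bar> * K" using K(2)[OF p] by (intro mult_left_mono) auto
    finally show "\<bar>v p\<bar> \<le> K / g p0 * \<bar>w p\<bar>" using pos by (simp add: field_simps)
  qed
qed

text \<open>With \<open>\<phi> = v / w\<close> the equation reads \<open>div (w\<^sup>2 \<nabla>\<phi>) = - \<beta> w \<phi>\<close>, so testing it with \<open>\<phi>\<close> on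
  \<open>{w < 0}\<close> yields \<open>\<integral> w\<^sup>2 \<bar>\<nabla>\<phi>\<bar>\<^sup>2 + \<beta> \<bar>w\<bar> \<phi>\<^sup>2 = 0\<close>. The factor \<open>1 / w\<close> of the test function is replaced
  by \<open>n\<^sup>3 / (n\<^sup>2 + e)\<^sup>2\<close> with \<open>n = min w 0\<close>, and the error vanishes as \<open>e \<longlonglongrightarrow> 0\<close>.\<close>

lemma negative_region:
  assumes C: "C \<ge> 0" "\<And>p. p \<in> band a b \<Longrightarrow> \<bar>v p\<bar> \<le> C * \<bar>w p\<bar>"
    and p: "p \<in> band a b" "w p < 0"
  shows "w p * vx p = v p * wx p" "w p * vy p = v p * wy p" "\<beta> * v p = 0"
proof -
  let ?Q = "cbox (0, a) (L, b)"
  define n where "n p = min (w p) 0" for p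
  define F1 where "F1 p = w p * vx p - v p * wx p" for p
  define F2 where "F2 p = w p * vy p - v p * wy p" for p
  \<comment> \<open>The fields \<open>F1\<close>, \<open>F2\<close> are the components of
    \<open>w\<^sup>2 \<nabla>\<phi>\<close>. The energy density \<open>h\<close> uses the weight for
    \<open>e = 1\<close>, the smallest among \<open>e \<le> 1\<close>; this is a continuous lower
    bound independent of \<open>e\<close>.\<close>
  define h where "h p = (n p / ((n p)\<^sup>2 + 1))\<^sup>2 * ((F1 p)\<^sup>2 + (F2 p)\<^sup>2)
      - \<beta> * (n p ^ 3 / ((n p)\<^sup>2 + 1)\<^sup>2) * (v p)\<^sup>2" for p
  define M where "M p = \<bar>wx p\<bar> * (\<bar>vx p\<bar> + C * \<bar>wx p\<bar>) + \<bar>wy p\<bar> * (\<bar>vy p\<bar> + C * \<bar>wy p\<bar>)" for p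
  define r where "r e p = e * n p ^ 4 / ((n p)\<^sup>2 + e) ^ 3" for e :: real and p
  have contn: "continuous_on (band a b) n" unfolding n_def by (intro continuous_intros wcont)
  have contF: "continuous_on (band a b) F1" "continuous_on (band a b) F2"
    unfolding F1_def F2_def by (intro continuous_intros wcont vcont)+
  have "continuous_on (band a b) M" unfolding M_def by (intro continuous_intros wcont vcont)
  then obtain K where K: "K \<ge> 0" "\<And>p. p \<in> ?Q \<Longrightarrow> \<bar>M p\<bar> \<le> K" using bounded_on_box by metis
  have nz: "(n p)\<^sup>2 + e \<noteq> 0" "0 < (n p)\<^sup>2 + e" if "e > 0" for e p
    using that by (smt (verit) zero_le_power2)+
  have conth: "continuous_on (band a b) h"
    unfolding h_def using nz[of 1] by (intro continuous_intros contn contF vcont) auto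
  have contr: "continuous_on (band a b) (r e)" if "e > 0" for e
    unfolding r_def using nz[OF that] by (intro continuous_intros contn) auto
  have n_nonpos: "n p \<le> 0" for p by (simp add: n_def)
  have h_nonneg: "h p \<ge> 0" for p
  proof -
    have "\<beta> * (n p ^ 3 / ((n p)\<^sup>2 + 1)\<^sup>2) * (v p)\<^sup>2 \<le> 0"
      using \<beta> n_nonpos[of p] by (intro mult_nonpos_nonneg mult_nonneg_nonpos divide_nonpos_nonneg)
        (auto simp: power3_eq_cube mult_nonneg_nonpos mult_nonpos_nonpos)
    then show ?thesis unfolding h_def by (smt (verit) sum_power2_ge_zero zero_le_power2 mult_nonneg_nonneg)
  qed
  have main: "integral ?Q h \<le> 4 * C * K * integral ?Q (r e)" if e: "e > 0" "e \<le> 1" for e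
  proof -
    define \<theta> where "\<theta> p = n p ^ 3 / ((n p)\<^sup>2 + e)\<^sup>2" for p
    define \<theta>' where "\<theta>' p = (n p)\<^sup>2 * (3 * e - (n p)\<^sup>2) / ((n p)\<^sup>2 + e) ^ 3" for p
    define Ax where "Ax p = (vx p * \<theta> p + v p * (\<theta>' p * wx p)) * F1 p
        + v p * \<theta> p * (w p * vxx p - v p * wxx p)" for p
    define By where "By p = (vy p * \<theta> p + v p * (\<theta>' p * wy p)) * F2 p
        + v p * \<theta> p * (w p * vyy p - v p * wyy p)" for p
    have d\<theta>: "((\<lambda>z. min z 0 ^ 3 / ((min z 0)\<^sup>2 + e)\<^sup>2) has_real_derivative \<theta>' p) (at (w p))" for p
    proof -
      have alg: "(3 * m\<^sup>2 * d\<^sup>2 - m ^ 3 * (2 * d * (2 * m))) / (d\<^sup>2 * d\<^sup>2)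
          = m\<^sup>2 * (3 * e - m\<^sup>2) / d ^ 3" if "d \<noteq> 0" "d = m\<^sup>2 + e" for m d :: real
      proof -
        have "3 * m\<^sup>2 * d\<^sup>2 - m ^ 3 * (2 * d * (2 * m)) = m\<^sup>2 * (3 * d - 4 * m\<^sup>2) * d"
          by (simp add: power2_eq_square power3_eq_cube algebra_simps)
        also have "3 * d - 4 * m\<^sup>2 = 3 * e - m\<^sup>2" using that(2) by simp
        finally show ?thesis
          using that(1) by (simp add: power2_eq_square power3_eq_cube)
      qed
      have d3: "((\<lambda>z. min z 0 ^ 3) has_real_derivative 3 * (n p)\<^sup>2) (at (w p))"
        using DERIV_min_zero_power[of 1 "w p"] by (simp add: numeral_3_eq_3 numeral_2_eq_2 n_def)
      have d2: "((\<lambda>z. (min z 0)\<^sup>2) has_real_derivative 2 * n p) (at (w p))"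
        using DERIV_min_zero_power[of 0 "w p"] by (simp add: numeral_2_eq_2 n_def)
      have d4: "((\<lambda>z. ((min z 0)\<^sup>2 + e)\<^sup>2) has_real_derivative 2 * ((n p)\<^sup>2 + e) * (2 * n p)) (at (w p))"
        using DERIV_power[OF DERIV_add[OF d2 DERIV_const[of e]], of 2]
        by (simp add: n_def algebra_simps)
      have "((\<lambda>z. min z 0 ^ 3 / ((min z 0)\<^sup>2 + e)\<^sup>2) has_real_derivative
          (3 * (n p)\<^sup>2 * ((n p)\<^sup>2 + e)\<^sup>2 - n p ^ 3 * (2 * ((n p)\<^sup>2 + e) * (2 * n p)))
            / (((n p)\<^sup>2 + e)\<^sup>2 * ((n p)\<^sup>2 + e)\<^sup>2)) (at (w p))"
        using DERIV_divide[OF d3 d4] nz[OF e(1), of p] by (simp add: n_def)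
      then show ?thesis using alg[OF nz(1)[OF e(1), of p] refl] by (simp add: \<theta>'_def)
    qed
    have \<theta>_eq: "\<theta> = (\<lambda>p. min (w p) 0 ^ 3 / ((min (w p) 0)\<^sup>2 + e)\<^sup>2)"
      by (simp add: fun_eq_iff \<theta>_def n_def)
    have dA: "dx_on a b (\<lambda>p. v p * \<theta> p * F1 p) Ax"
      unfolding dx_on_def
    proof (intro allI ballI)
      fix x y assume y: "y \<in> {a..b}"
      have d1: "((\<lambda>x. \<theta> (x, y)) has_real_derivative \<theta>' (x, y) * wx (x, y)) (at x)"
        unfolding \<theta>_eq using DERIV_chain2[OF d\<theta> dx_onD[OF wdx(1) y]] .
      have d2: "((\<lambda>x. F1 (x, y)) has_real_derivative w (x, y) * vxx (x, y) - v (x, y) * wxx (x, y)) (at x)"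
        unfolding F1_def
        by (auto intro!: derivative_eq_intros dx_onD[OF wdx(1) y] dx_onD[OF wdx(2) y]
            dx_onD[OF vdx(1) y] dx_onD[OF vdx(2) y])
      show "((\<lambda>x. v (x, y) * \<theta> (x, y) * F1 (x, y)) has_real_derivative Ax (x, y)) (at x)"
        unfolding Ax_def
        by (auto intro!: derivative_eq_intros dx_onD[OF vdx(1) y] d1 d2)
    qed
    have dB: "dy_on a b (\<lambda>p. v p * \<theta> p * F2 p) By"
      unfolding dy_on_def
    proof (intro allI ballI)
      fix x y assume y: "y \<in> {a..b}"
      have d1: "((\<lambda>y. \<theta> (x, y)) has_real_derivative \<theta>' (x, y) * wy (x, y)) (at y within {a..b})"
        unfolding \<theta>_eq using DERIV_chain2[OF d\<theta> dy_onD[OF wdy(1) y]] .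
      have d2: "((\<lambda>y. F2 (x, y)) has_real_derivative w (x, y) * vyy (x, y) - v (x, y) * wyy (x, y))
          (at y within {a..b})"
        unfolding F2_def
        by (auto intro!: derivative_eq_intros dy_onD[OF wdy(1) y] dy_onD[OF wdy(3) y]
            dy_onD[OF vdy(1) y] dy_onD[OF vdy(3) y])
      show "((\<lambda>y. v (x, y) * \<theta> (x, y) * F2 (x, y)) has_real_derivative By (x, y)) (at y within {a..b})"
        unfolding By_def
        by (auto intro!: derivative_eq_intros dy_onD[OF vdy(1) y] d1 d2)
    qed
    have cont\<theta>: "continuous_on (band a b) \<theta>" "continuous_on (band a b) \<theta>'"
      unfolding \<theta>_def \<theta>'_def using nz[OF e(1)] by (intro continuous_intros contn; force)+
    have cA: "continuous_on (band a b) Ax" and cB: "continuous_on (band a b) By"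
      unfolding Ax_def By_def by (intro continuous_intros cont\<theta> contF wcont vcont)+
    have key: "h p \<le> (Ax p + By p) + 4 * C * K * r e p" if pQ: "p \<in> ?Q" for p
    proof (cases "w p < 0")
      case False
      then have "n p = 0" by (simp add: n_def)
      then show ?thesis by (simp add: h_def Ax_def By_def r_def \<theta>_def \<theta>'_def)
    next
      case True
      have pb: "p \<in> band a b" using pQ cbox_subset_band by blast
      define d where "d = 1 / ((w p)\<^sup>2 + e)"
      have nw: "n p = w p" using True by (simp add: n_def)
      have d0: "d > 0" using nz(2)[OF e(1), of p] by (simp add: d_def nw)
      have d1: "((w p)\<^sup>2 + e) * d = 1" using nz(1)[OF e(1), of p] by (simp add: d_def nw)
      have \<theta>: "\<theta> p = w p ^ 3 * d\<^sup>2" by (simp add: \<theta>_def nw d_def power_divide)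
      \<comment> \<open>Writing \<open>3 * e - w\<^sup>2\<close> as
        \<open>4 * e - (w\<^sup>2 + e)\<close> separates the error, which carries a factor
        \<open>e\<close>, from the part that combines with
        \<open>\<theta> * (vx * F1 + vy * F2)\<close> into a multiple of
        \<open>F1\<^sup>2 + F2\<^sup>2\<close>.\<close>
      have "\<theta>' p = (w p)\<^sup>2 * (4 * e - ((w p)\<^sup>2 + e)) * d ^ 3"
        by (simp add: \<theta>'_def nw d_def power_divide)
      also have "\<dots> = 4 * e * (w p)\<^sup>2 * d ^ 3 - (w p)\<^sup>2 * d\<^sup>2 * (((w p)\<^sup>2 + e) * d)"
        by (simp add: algebra_simps power2_eq_square power3_eq_cube)
      finally have \<theta>': "\<theta>' p = 4 * e * (w p)\<^sup>2 * d ^ 3 - (w p)\<^sup>2 * d\<^sup>2" by (simp add: d1)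
      define G where "G = v p * (wx p * F1 p + wy p * F2 p)"
      have vor: "w p * (vxx p + vyy p) - v p * (wxx p + wyy p) = - \<beta> * v p"
        using vorticity[OF pb] by (simp add: algebra_simps)
      have "Ax p + By p = v p * \<theta> p * (w p * (vxx p + vyy p) - v p * (wxx p + wyy p))
          + \<theta> p * (vx p * F1 p + vy p * F2 p) + \<theta>' p * G"
        by (simp add: Ax_def By_def G_def algebra_simps)
      also have "\<dots> = (w p * d)\<^sup>2 * ((F1 p)\<^sup>2 + (F2 p)\<^sup>2) - \<beta> * (w p ^ 3 * d\<^sup>2) * (v p)\<^sup>2
          + 4 * e * (w p)\<^sup>2 * d ^ 3 * G"
        unfolding vor \<theta> \<theta>' G_def F1_def F2_def
        by (simp add: algebra_simps power2_eq_square power3_eq_cube)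
      finally have AB: "Ax p + By p = (w p * d)\<^sup>2 * ((F1 p)\<^sup>2 + (F2 p)\<^sup>2)
          - \<beta> * (w p ^ 3 * d\<^sup>2) * (v p)\<^sup>2 + 4 * e * (w p)\<^sup>2 * d ^ 3 * G" .
      define d' where "d' = 1 / ((w p)\<^sup>2 + 1)"
      have d': "0 \<le> d'" "d' \<le> d"
        using e nz(2)[OF e(1), of p] unfolding d'_def d_def
        by (auto simp: nw intro!: divide_left_mono mult_pos_pos add_nonneg_pos)
      have "h p = (w p * d')\<^sup>2 * ((F1 p)\<^sup>2 + (F2 p)\<^sup>2) - \<beta> * (w p ^ 3 * d'\<^sup>2) * (v p)\<^sup>2"
        by (simp add: h_def nw d'_def power_divide)
      also have "\<dots> \<le> (w p * d)\<^sup>2 * ((F1 p)\<^sup>2 + (F2 p)\<^sup>2) - \<beta> * (w p ^ 3 * d\<^sup>2) * (v p)\<^sup>2"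
      proof (intro diff_mono mult_right_mono mult_left_mono[OF _ \<beta>])
        have "d'\<^sup>2 \<le> d\<^sup>2" using d' by (intro power_mono)
        then show "(w p * d')\<^sup>2 \<le> (w p * d)\<^sup>2" by (simp add: power_mult_distrib mult_left_mono)
        show "w p ^ 3 * d\<^sup>2 \<le> w p ^ 3 * d'\<^sup>2"
          using \<open>d'\<^sup>2 \<le> d\<^sup>2\<close> True by (intro mult_left_mono_neg) (auto simp: power3_eq_cube mult_nonneg_nonpos mult_nonpos_nonpos)
      qed auto
      finally have h_le: "h p \<le> (w p * d)\<^sup>2 * ((F1 p)\<^sup>2 + (F2 p)\<^sup>2) - \<beta> * (w p ^ 3 * d\<^sup>2) * (v p)\<^sup>2" .
      \<comment> \<open>The bound \<open>\<bar>v\<bar> \<le> C * \<bar>w\<bar>\<close> makes both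
        \<open>v\<close> and the fields \<open>F1\<close>, \<open>F2\<close> of order
        \<open>w\<close>, hence \<open>G\<close> of order \<open>w\<^sup>2\<close>. The error is
        then at most a multiple of \<open>r e\<close>.\<close>
      have F1: "\<bar>F1 p\<bar> \<le> \<bar>w p\<bar> * (\<bar>vx p\<bar> + C * \<bar>wx p\<bar>)"
      proof -
        have "\<bar>F1 p\<bar> \<le> \<bar>w p\<bar> * \<bar>vx p\<bar> + \<bar>v p\<bar> * \<bar>wx p\<bar>"
          unfolding F1_def by (metis abs_mult abs_triangle_ineq4)
        also have "\<dots> \<le> \<bar>w p\<bar> * \<bar>vx p\<bar> + C * \<bar>w p\<bar> * \<bar>wx p\<bar>"
          using C(2)[OF pb] by (intro add_left_mono mult_right_mono) auto
        finally show ?thesis by (simp add: algebra_simps)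
      qed
      have F2: "\<bar>F2 p\<bar> \<le> \<bar>w p\<bar> * (\<bar>vy p\<bar> + C * \<bar>wy p\<bar>)"
      proof -
        have "\<bar>F2 p\<bar> \<le> \<bar>w p\<bar> * \<bar>vy p\<bar> + \<bar>v p\<bar> * \<bar>wy p\<bar>"
          unfolding F2_def by (metis abs_mult abs_triangle_ineq4)
        also have "\<dots> \<le> \<bar>w p\<bar> * \<bar>vy p\<bar> + C * \<bar>w p\<bar> * \<bar>wy p\<bar>"
          using C(2)[OF pb] by (intro add_left_mono mult_right_mono) auto
        finally show ?thesis by (simp add: algebra_simps)
      qed
      have "\<bar>G\<bar> \<le> (C * \<bar>w p\<bar>) * (\<bar>w p\<bar> * M p)"
        unfolding G_def abs_mult
      proof (intro mult_mono C(2)[OF pb])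
        have "\<bar>wx p * F1 p + wy p * F2 p\<bar> \<le> \<bar>wx p\<bar> * \<bar>F1 p\<bar> + \<bar>wy p\<bar> * \<bar>F2 p\<bar>"
          by (metis abs_mult abs_triangle_ineq)
        also have "\<dots> \<le> \<bar>wx p\<bar> * (\<bar>w p\<bar> * (\<bar>vx p\<bar> + C * \<bar>wx p\<bar>)) + \<bar>wy p\<bar> * (\<bar>w p\<bar> * (\<bar>vy p\<bar> + C * \<bar>wy p\<bar>))"
          by (intro add_mono mult_left_mono F1 F2) auto
        finally show "\<bar>wx p * F1 p + wy p * F2 p\<bar> \<le> \<bar>w p\<bar> * M p"
          by (simp add: M_def algebra_simps)
      qed (use C(1) in auto)
      also have "\<dots> \<le> C * K * (w p)\<^sup>2"
      proof -
        have "C * (w p)\<^sup>2 * M p \<le> C * (w p)\<^sup>2 * K" using K(2)[OF pQ] C(1) by (intro mult_left_mono) auto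
        then show ?thesis by (simp add: power2_eq_square mult_ac)
      qed
      finally have "- (C * K * (w p)\<^sup>2) \<le> G" by simp
      then have "4 * e * (w p)\<^sup>2 * d ^ 3 * (- (C * K * (w p)\<^sup>2)) \<le> 4 * e * (w p)\<^sup>2 * d ^ 3 * G"
        using e d0 by (intro mult_left_mono) auto
      then have "- (4 * e * (w p)\<^sup>2 * d ^ 3 * (C * K * (w p)\<^sup>2)) \<le> 4 * e * (w p)\<^sup>2 * d ^ 3 * G"
        unfolding mult_minus_right .
      moreover have "4 * C * K * r e p = 4 * e * (w p)\<^sup>2 * d ^ 3 * (C * K * (w p)\<^sup>2)"
        by (simp add: r_def nw d_def power_divide power2_eq_square power4_eq_xxxx)
      ultimately show ?thesis using h_le AB by linarith
    qed
    have cAB: "continuous_on ?Q (\<lambda>p. Ax p + By p)"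
      by (intro continuous_intros continuous_on_subset[OF cA cbox_subset_band]
          continuous_on_subset[OF cB cbox_subset_band])
    have cr: "continuous_on ?Q (r e)" using continuous_on_subset[OF contr[OF e(1)] cbox_subset_band] .
    have "integral ?Q h \<le> integral ?Q (\<lambda>p. (Ax p + By p) + 4 * C * K * r e p)"
      using key by (intro integral_le integrable_continuous continuous_intros cAB cr
          continuous_on_subset[OF conth cbox_subset_band])
    also have "\<dots> = integral ?Q (\<lambda>p. Ax p + By p) + 4 * C * K * integral ?Q (r e)"
      using cAB cr by (simp add: integral_add integrable_continuous continuous_on_mult_left)
    also have "integral ?Q (\<lambda>p. Ax p + By p) = integral {0..L} (\<lambda>x. v (x, b) * \<theta> (x, b) * F2 (x, b)
        - v (x, a) * \<theta> (x, a) * F2 (x, a))"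
      by (intro integral_divergence[OF L less_imp_le[OF ab] dA dB cA cB])
        (auto simp: F1_def \<theta>_def n_def periodic_end)
    also have "\<dots> = 0" by (simp add: v_bdry)
    finally show ?thesis by simp
  qed
  have lim: "(\<lambda>k. integral ?Q (r (inverse (real (Suc k))))) \<longlonglongrightarrow> integral ?Q (\<lambda>p. 0)"
  proof (rule dominated_convergence(2)[where h = "\<lambda>p. 1"])
    fix k
    show "r (inverse (real (Suc k))) integrable_on ?Q"
      by (intro integrable_continuous continuous_on_subset[OF contr cbox_subset_band]) simp
    show "norm (r (inverse (real (Suc k))) p) \<le> 1" for p
      using power4_le_cube[of "inverse (real (Suc k))" "n p"] by (simp add: r_def)
  qed (use power4_cube_tendsto in \<open>auto simp: r_def integrable_const\<close>)
  have "integral ?Q h \<le> 4 * C * K * integral ?Q (r (inverse (real (Suc k))))" for k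
    by (rule main) (auto simp: field_simps)
  then have "integral ?Q h \<le> 4 * C * K * integral ?Q (\<lambda>p. 0)"
    by (intro tendsto_lowerbound[OF tendsto_mult_left[OF lim]] always_eventually allI) auto
  then have int_h: "integral ?Q h \<le> 0" by simp
  have hper: "x_periodic L a b h"
    using wper' vper' by (auto simp: x_periodic_def h_def n_def F1_def F2_def)
  obtain q where q: "q \<in> ?Q" "h q = h p" using x_periodic_box[OF L hper p(1)] by metis
  have hp: "h p = 0"
    using integral_nonpos_imp_zero[OF L ab continuous_on_subset[OF conth cbox_subset_band] h_nonneg int_h q(1)] q(2)
    by simp
  define d where "d = 1 / ((w p)\<^sup>2 + 1)"
  have d: "d > 0" unfolding d_def by (smt (verit) zero_le_power2 divide_pos_pos)
  have nw: "n p = w p" using p(2) by (simp add: n_def)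
  have "(w p * d)\<^sup>2 * ((F1 p)\<^sup>2 + (F2 p)\<^sup>2) + \<beta> * ((- w p) ^ 3 * d\<^sup>2) * (v p)\<^sup>2 = 0"
    using hp by (simp add: h_def nw d_def power_divide power3_eq_cube)
  moreover have "(w p * d)\<^sup>2 * ((F1 p)\<^sup>2 + (F2 p)\<^sup>2) \<ge> 0" by simp
  moreover have "\<beta> * ((- w p) ^ 3 * d\<^sup>2) * (v p)\<^sup>2 \<ge> 0"
    using \<beta> p(2) zero_le_power[of "- w p" 3] by (intro mult_nonneg_nonneg) auto
  ultimately have 1: "(w p * d)\<^sup>2 * ((F1 p)\<^sup>2 + (F2 p)\<^sup>2) = 0" "\<beta> * ((- w p) ^ 3 * d\<^sup>2) * (v p)\<^sup>2 = 0"
    by linarith+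
  from 1(1) have "F1 p = 0 \<and> F2 p = 0"
    using p(2) d by (simp add: sum_power2_eq_zero_iff)
  then show "w p * vx p = v p * wx p" "w p * vy p = v p * wy p" by (auto simp: F1_def F2_def)
  show "\<beta> * v p = 0" using 1(2) p(2) d by auto
qed

end

section \<open>Mean values, reflection and differentiation along lines\<close>

lemma dy_on_mvt_near:
  assumes f: "dy_on a b f f'" and st: "s \<in> {a..b}" "t \<in> {a..b}"
  obtains y where "y \<in> {a..b}" "\<bar>y - s\<bar> \<le> \<bar>t - s\<bar>" "f (x, t) - f (x, s) = f' (x, y) * (t - s)"
proof (cases "s \<le> t")
  case True
  then obtain y where "y \<in> {s..t}" "f (x, t) - f (x, s) = f' (x, y) * (t - s)"
    using dy_on_mvt[OF f, of s t x] st by force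
  with st show ?thesis by (intro that[of y]) auto
next
  case False
  then obtain y where y: "y \<in> {t..s}" "f (x, s) - f (x, t) = f' (x, y) * (s - t)"
    using dy_on_mvt[OF f, of t s x] st by force
  then have "f (x, t) - f (x, s) = f' (x, y) * (t - s)" by (simp add: algebra_simps)
  with y(1) st show ?thesis by (intro that[of y]) auto
qed

lemma C1_on_subset:
  assumes "C1_on a b f fx fy" "a \<le> a'" "b' \<le> b"
  shows "C1_on a' b' f fx fy"
proof -
  have "band a' b' \<subseteq> band a b" using assms(2,3) by (auto simp: band_def)
  then show ?thesis
    using assms dx_on_subset[OF _ assms(2,3)] dy_on_subset[OF _ assms(2,3)] continuous_on_subset
    unfolding C1_on_def by blast
qed

lemma C1_on_minus:
  assumes "C1_on a b f fx fy"
  shows "C1_on a b (\<lambda>p. - f p) (\<lambda>p. - fx p) (\<lambda>p. - fy p)"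
  using assms unfolding C1_on_def dx_on_def dy_on_def
  by (auto intro!: continuous_intros DERIV_minus)

text \<open>Continuation from a line goes upwards in \<open>strip_unique_continuation\<close>;
  reflecting in \<open>y\<close> makes it available downwards as well.\<close>

lemma C1_on_reflect:
  assumes f: "C1_on a b f fx fy"
  shows "C1_on (- b) (- a) (\<lambda>p. f (fst p, - snd p)) (\<lambda>p. fx (fst p, - snd p)) (\<lambda>p. - fy (fst p, - snd p))"
proof -
  have c: "continuous_on (band (- b) (- a)) (\<lambda>p. g (fst p, - snd p))"
    if "continuous_on (band a b) g" for g :: "real \<times> real \<Rightarrow> real"
    by (rule continuous_on_compose2[OF that]) (auto intro!: continuous_intros)
  have "dx_on (- b) (- a) (\<lambda>p. f (fst p, - snd p)) (\<lambda>p. fx (fst p, - snd p))"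
    using C1_onD(1)[OF f] by (simp add: dx_on_def)
  moreover have "dy_on (- b) (- a) (\<lambda>p. f (fst p, - snd p)) (\<lambda>p. - fy (fst p, - snd p))"
    unfolding dy_on_def
  proof (intro allI ballI)
    fix x y assume y: "y \<in> {- b..- a}"
    have im: "uminus ` {- b..- a} = {a..b}" by simp
    have "((\<lambda>s. f (x, s)) has_real_derivative fy (x, - y)) (at (- y) within uminus ` {- b..- a})"
      unfolding im by (rule dy_onD[OF C1_onD(2)[OF f]]) (use y in auto)
    moreover have "(uminus has_real_derivative - 1) (at y within {- b..- a})"
      by (auto intro!: derivative_eq_intros)
    ultimately have "((\<lambda>s. f (x, - s)) has_real_derivative fy (x, - y) * - 1) (at y within {- b..- a})"
      using DERIV_image_chain[of "\<lambda>s. f (x, s)" "fy (x, - y)" uminus y "{- b..- a}" "- 1"]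
      by (simp add: o_def)
    then show "((\<lambda>s. f (fst (x, s), - snd (x, s))) has_real_derivative - fy (fst (x, y), - snd (x, y)))
        (at y within {- b..- a})"
      by simp
  qed
  ultimately show ?thesis
    unfolding C1_on_def using c C1_onD(3-5)[OF f] by (auto intro: continuous_intros)
qed

text \<open>Continuity of \<open>fy\<close> upgrades the partial derivatives to a total derivative
  within the band, and the chain rule applies along a segment that may end on a wall.\<close>

lemma C1_on_DERIV_line:
  assumes f: "C1_on a b f fx fy"
    and S: "\<And>t. t \<in> {0..T} \<Longrightarrow> y0 + t * k \<in> {a..b}" and t: "t \<in> {0..T}"
  shows "((\<lambda>t. f (x0 + t * h, y0 + t * k)) has_real_derivative
      fx (x0 + t * h, y0 + t * k) * h + fy (x0 + t * h, y0 + t * k) * k) (at t within {0..T})"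
proof -
  define x y where "x = x0 + t * h" and "y = y0 + t * k"
  have y: "y \<in> {a..b}" using S[OF t] by (simp add: y_def)
  have "((\<lambda>(x, y). f (x, y)) has_derivative
      (\<lambda>(tx, ty). fx (x, y) * tx + blinfun_mult_right (fy (x, y)) ty)) (at (x, y) within UNIV \<times> {a..b})"
  proof (rule has_derivative_partialsI)
    show "((\<lambda>x. f (x, y)) has_derivative (*) (fx (x, y))) (at x)"
      using dx_onD[OF C1_onD(1)[OF f] y] by (simp add: has_field_derivative_def)
    show "((\<lambda>y. f (x, y)) has_derivative blinfun_apply (blinfun_mult_right (fy (x, y)))) (at y within {a..b})"
      if "y \<in> {a..b}" for x y
      using dy_onD[OF C1_onD(2)[OF f] that] by (simp add: has_field_derivative_def)
    have "continuous_on (band a b) (\<lambda>p. blinfun_mult_right (fy p))"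
      by (rule bounded_linear.continuous_on[OF bounded_linear_blinfun_mult_right C1_onD(5)[OF f]])
    then show "continuous (at (x, y) within UNIV \<times> {a..b}) (\<lambda>(x, y). blinfun_mult_right (fy (x, y)))"
      using y by (auto simp: continuous_on_eq_continuous_within band_def case_prod_unfold)
  qed (use y in auto)
  then have D: "(f has_derivative (\<lambda>q. fx (x, y) * fst q + fy (x, y) * snd q)) (at (x, y) within band a b)"
    by (simp add: case_prod_unfold band_def)
  have g: "((\<lambda>t. (x0 + t * h, y0 + t * k)) has_derivative (\<lambda>s. (s * h, s * k))) (at t within {0..T})"
    by (auto intro!: derivative_eq_intros)
  have "(\<lambda>t. (x0 + t * h, y0 + t * k)) ` {0..T} \<subseteq> band a b" using S by auto
  from has_derivative_in_compose[OF g has_derivative_subset[OF D[unfolded x_def y_def] this]]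
  have "((\<lambda>t. f (x0 + t * h, y0 + t * k)) has_derivative (\<lambda>s. fx (x, y) * (s * h) + fy (x, y) * (s * k)))
      (at t within {0..T})"
    by (simp add: x_def y_def)
  moreover have "(\<lambda>s. fx (x, y) * (s * h) + fy (x, y) * (s * k)) = (*) (fx (x, y) * h + fy (x, y) * k)"
    by (auto simp: algebra_simps)
  ultimately show ?thesis
    by (simp add: has_field_derivative_def x_def y_def)
qed

section \<open>Poincare estimate when \<open>w\<close> is bounded below\<close>

context vorticity_pair
begin

text \<open>For \<open>\<kappa> (b - a) < \<pi>\<close> the function \<open>cos (\<kappa> (y - (a + b) / 2))\<close> is positive on \<open>[a, b]\<close>; completing
  the square with its logarithmic derivative gives the Poincare inequality
  \<open>\<integral> \<phi>\<^sub>y\<^sup>2 \<ge> \<kappa>\<^sup>2 \<integral> \<phi>\<^sup>2\<close> for \<open>\<phi> = v / w\<close>, without the singularity of the optimal \<open>\<kappa> = \<pi> / (b - a)\<close>.\<close>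

lemma positive_rigidity:
  assumes m: "m > 0" "\<And>p. p \<in> band a b \<Longrightarrow> m \<le> w p"
    and R: "\<And>p. p \<in> band a b \<Longrightarrow> w p \<le> R"
    and large: "\<beta> * R < (m * (pi / (b - a)))\<^sup>2"
    and p: "p \<in> band a b"
  shows "v p = 0"
proof -
  let ?Q = "cbox (0, a) (L, b)"
  have "(0, a) \<in> band a b" using ab by simp
  with m R have "0 < R" by (meson less_le_trans)
  have "sqrt (\<beta> * R) < m * (pi / (b - a))"
    using large m(1) ab by (intro real_less_lsqrt) (auto intro!: mult_nonneg_nonneg divide_nonneg_nonneg)
  then have "sqrt (\<beta> * R) / m < pi / (b - a)" using m(1) by (simp add: field_simps)
  \<comment> \<open>The strict inequality \<open>large\<close> leaves room below the optimal
    constant; this room becomes the positive factor \<open>\<delta>\<close> in the final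
    estimate.\<close>
  then obtain \<kappa> where \<kappa>: "sqrt (\<beta> * R) / m < \<kappa>" "\<kappa> < pi / (b - a)" using dense by blast
  have "0 \<le> sqrt (\<beta> * R) / m" using \<beta> \<open>0 < R\<close> m(1) by simp
  then have \<kappa>0: "\<kappa> > 0" using \<kappa>(1) by linarith
  have "sqrt (\<beta> * R) < m * \<kappa>" using \<kappa>(1) m(1) by (simp add: field_simps)
  then have gap: "\<beta> * R < (m * \<kappa>)\<^sup>2"
    using power_strict_mono[of "sqrt (\<beta> * R)" "m * \<kappa>" 2] \<beta> \<open>0 < R\<close> by simp
  define c where "c p = \<kappa> * (snd p - (a + b) / 2)" for p :: "real \<times> real"
  have cos_pos: "cos (c p) > 0" if "p \<in> band a b" for p
  proof (rule cos_gt_zero_pi)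
    have "\<kappa> * (b - a) < pi" using \<kappa>(2) ab by (simp add: field_simps)
    moreover have "\<bar>c p\<bar> \<le> \<kappa> * ((b - a) / 2)"
    proof -
      have "\<bar>snd p - (a + b) / 2\<bar> \<le> (b - a) / 2"
        using that by (cases p) (auto simp: abs_le_iff field_simps)
      then show ?thesis using \<kappa>0 by (simp add: c_def abs_mult)
    qed
    ultimately have "\<bar>c p\<bar> < pi / 2" by (simp add: field_simps)
    then show "- (pi / 2) < c p" "c p < pi / 2" by auto
  qed
  have w0: "w p > 0" if "p \<in> band a b" for p using m(1) m(2)[OF that] by linarith
  \<comment> \<open>\<open>T\<close> is minus the logarithmic derivative of \<open>cos (c p)\<close>
    in \<open>y\<close> and solves the Riccati equation
    \<open>T' = \<kappa>\<^sup>2 + T\<^sup>2\<close>. Adding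
    \<open>m\<^sup>2 * T * \<phi>\<^sup>2\<close> to the flux therefore supplies what completes the
    square of \<open>g + T * \<phi>\<close>, where \<open>g\<close> is the
    \<open>y\<close>-derivative of \<open>\<phi>\<close>; the added flux vanishes on the
    walls.\<close>
  define T where "T p = \<kappa> * tan (c p)" for p
  define \<phi> where "\<phi> p = v p / w p" for p
  define F1 where "F1 p = w p * vx p - v p * wx p" for p
  define F2 where "F2 p = w p * vy p - v p * wy p" for p
  define Ax where "Ax p = F1 p / (w p)\<^sup>2 * F1 p + \<phi> p * (w p * vxx p - v p * wxx p)" for p
  define By where "By p = F2 p / (w p)\<^sup>2 * F2 p + \<phi> p * (w p * vyy p - v p * wyy p)
      + m\<^sup>2 * ((\<kappa>\<^sup>2 + (T p)\<^sup>2) * (\<phi> p)\<^sup>2 + T p * (2 * \<phi> p * (F2 p / (w p)\<^sup>2)))" for p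
  define \<delta> where "\<delta> = (m * \<kappa>)\<^sup>2 - \<beta> * R"
  have w0': "w p \<noteq> 0" if "p \<in> band a b" for p using w0[OF that] by simp
  have cos0: "cos (c p) \<noteq> 0" if "p \<in> band a b" for p using cos_pos[OF that] by simp
  have contc: "continuous_on (band a b) c" unfolding c_def by (intro continuous_intros)
  have contT: "continuous_on (band a b) T"
    unfolding T_def tan_def using cos0 by (intro continuous_intros contc) auto
  have cont\<phi>: "continuous_on (band a b) \<phi>"
    unfolding \<phi>_def using w0' by (intro continuous_intros wcont vcont) auto
  have contF: "continuous_on (band a b) F1" "continuous_on (band a b) F2"
    unfolding F1_def F2_def by (intro continuous_intros wcont vcont)+
  have cA: "continuous_on (band a b) Ax" and cB: "continuous_on (band a b) By"
    unfolding Ax_def By_def using w0'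
    by (intro continuous_intros contT cont\<phi> contF wcont vcont; auto)+
  have dA: "dx_on a b (\<lambda>p. \<phi> p * F1 p) Ax"
    unfolding dx_on_def
  proof (intro allI ballI)
    fix x y assume y: "y \<in> {a..b}"
    have nz: "w (x, y) \<noteq> 0" using w0'[of "(x, y)"] y by simp
    have d1: "((\<lambda>x. \<phi> (x, y)) has_real_derivative F1 (x, y) / (w (x, y))\<^sup>2) (at x)"
      unfolding \<phi>_def F1_def using nz
      by (auto intro!: derivative_eq_intros dx_onD[OF wdx(1) y] dx_onD[OF vdx(1) y]
          simp: power2_eq_square algebra_simps)
    have d2: "((\<lambda>x. F1 (x, y)) has_real_derivative w (x, y) * vxx (x, y) - v (x, y) * wxx (x, y)) (at x)"
      unfolding F1_def
      by (auto intro!: derivative_eq_intros dx_onD[OF wdx(1) y] dx_onD[OF wdx(2) y]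
          dx_onD[OF vdx(1) y] dx_onD[OF vdx(2) y])
    show "((\<lambda>x. \<phi> (x, y) * F1 (x, y)) has_real_derivative Ax (x, y)) (at x)"
      unfolding Ax_def by (auto intro!: derivative_eq_intros d1 d2)
  qed
  have dB: "dy_on a b (\<lambda>p. \<phi> p * F2 p + m\<^sup>2 * (T p * (\<phi> p)\<^sup>2)) By"
    unfolding dy_on_def
  proof (intro allI ballI)
    fix x y assume y: "y \<in> {a..b}"
    have nz: "w (x, y) \<noteq> 0" using w0'[of "(x, y)"] y by simp
    have nc: "cos (c (x, y)) \<noteq> 0" using cos0[of "(x, y)"] y by simp
    have d1: "((\<lambda>y. \<phi> (x, y)) has_real_derivative F2 (x, y) / (w (x, y))\<^sup>2) (at y within {a..b})"
      unfolding \<phi>_def F2_def using nz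
      by (auto intro!: derivative_eq_intros dy_onD[OF wdy(1) y] dy_onD[OF vdy(1) y]
          simp: power2_eq_square algebra_simps)
    have d2: "((\<lambda>y. F2 (x, y)) has_real_derivative w (x, y) * vyy (x, y) - v (x, y) * wyy (x, y))
        (at y within {a..b})"
      unfolding F2_def
      by (auto intro!: derivative_eq_intros dy_onD[OF wdy(1) y] dy_onD[OF wdy(3) y]
          dy_onD[OF vdy(1) y] dy_onD[OF vdy(3) y])
    have sec: "inverse ((cos (c (x, y)))\<^sup>2) = 1 + (tan (c (x, y)))\<^sup>2"
      using tan_sec[OF nc] by (simp add: power_inverse)
    have dc: "((\<lambda>y. c (x, y)) has_real_derivative \<kappa>) (at y within {a..b})"
      unfolding c_def by (auto intro!: derivative_eq_intros)
    have d3: "((\<lambda>y. T (x, y)) has_real_derivative \<kappa>\<^sup>2 + (T (x, y))\<^sup>2) (at y within {a..b})"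
      using DERIV_cmult[OF DERIV_chain2[OF DERIV_tan[OF nc] dc], of \<kappa>]
      unfolding T_def sec by (simp add: algebra_simps power2_eq_square)
    show "((\<lambda>y. \<phi> (x, y) * F2 (x, y) + m\<^sup>2 * (T (x, y) * (\<phi> (x, y))\<^sup>2)) has_real_derivative By (x, y))
        (at y within {a..b})"
      unfolding By_def by (auto intro!: derivative_eq_intros d1 d2 d3)
  qed
  have key: "\<delta> * (\<phi> p)\<^sup>2 \<le> Ax p + By p" if pQ: "p \<in> ?Q" for p
  proof -
    have pb: "p \<in> band a b" using pQ cbox_subset_band by blast
    have wp: "w p > 0" using w0[OF pb] .
    define g where "g = F2 p / (w p)\<^sup>2"
    have F2g: "F2 p = g * (w p)\<^sup>2" using wp by (simp add: g_def)
    have vor: "w p * (vxx p + vyy p) - v p * (wxx p + wyy p) = - \<beta> * v p"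
      using vorticity[OF pb] by (simp add: algebra_simps)
    have v\<phi>: "v p = w p * \<phi> p" using wp by (simp add: \<phi>_def)
    have "Ax p + By p = (F1 p / w p)\<^sup>2 + \<phi> p * (w p * (vxx p + vyy p) - v p * (wxx p + wyy p))
        + g * F2 p + m\<^sup>2 * ((\<kappa>\<^sup>2 + (T p)\<^sup>2) * (\<phi> p)\<^sup>2 + T p * (2 * \<phi> p * g))"
      by (simp add: Ax_def By_def g_def algebra_simps power2_eq_square)
    also have "\<dots> = (F1 p / w p)\<^sup>2 - \<beta> * w p * (\<phi> p)\<^sup>2
        + (w p)\<^sup>2 * g\<^sup>2 + m\<^sup>2 * ((\<kappa>\<^sup>2 + (T p)\<^sup>2) * (\<phi> p)\<^sup>2 + T p * (2 * \<phi> p * g))"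
      unfolding vor F2g by (simp add: v\<phi> algebra_simps power2_eq_square)
    also have "\<dots> \<ge> 0 - \<beta> * R * (\<phi> p)\<^sup>2
        + m\<^sup>2 * g\<^sup>2 + m\<^sup>2 * ((\<kappa>\<^sup>2 + (T p)\<^sup>2) * (\<phi> p)\<^sup>2 + T p * (2 * \<phi> p * g))"
    proof -
      have "\<beta> * w p * (\<phi> p)\<^sup>2 \<le> \<beta> * R * (\<phi> p)\<^sup>2"
        using R[OF pb] \<beta> by (intro mult_right_mono mult_left_mono) auto
      moreover have "m\<^sup>2 * g\<^sup>2 \<le> (w p)\<^sup>2 * g\<^sup>2"
        using m(1) m(2)[OF pb] by (intro mult_right_mono power_mono) auto
      moreover have "0 \<le> (F1 p / w p)\<^sup>2" by simp
      ultimately show ?thesis by linarith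
    qed
    also have "0 - \<beta> * R * (\<phi> p)\<^sup>2
        + m\<^sup>2 * g\<^sup>2 + m\<^sup>2 * ((\<kappa>\<^sup>2 + (T p)\<^sup>2) * (\<phi> p)\<^sup>2 + T p * (2 * \<phi> p * g))
        = \<delta> * (\<phi> p)\<^sup>2 + m\<^sup>2 * (g + T p * \<phi> p)\<^sup>2"
      by (simp add: \<delta>_def algebra_simps power2_eq_square)
    finally show ?thesis by (smt (verit) mult_nonneg_nonneg zero_le_power2)
  qed
  have cQ: "continuous_on ?Q (\<lambda>p. \<delta> * (\<phi> p)\<^sup>2)" "continuous_on ?Q (\<lambda>p. Ax p + By p)"
    by (intro continuous_intros continuous_on_subset[OF cont\<phi> cbox_subset_band]
        continuous_on_subset[OF cA cbox_subset_band] continuous_on_subset[OF cB cbox_subset_band])+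
  have "integral ?Q (\<lambda>p. \<delta> * (\<phi> p)\<^sup>2) \<le> integral ?Q (\<lambda>p. Ax p + By p)"
    using key by (intro integral_le integrable_continuous cQ)
  also have "\<dots> = integral {0..L} (\<lambda>x. (\<phi> (x, b) * F2 (x, b) + m\<^sup>2 * (T (x, b) * (\<phi> (x, b))\<^sup>2))
      - (\<phi> (x, a) * F2 (x, a) + m\<^sup>2 * (T (x, a) * (\<phi> (x, a))\<^sup>2)))"
    by (intro integral_divergence[OF L less_imp_le[OF ab] dA dB cA cB])
       (auto simp: \<phi>_def F1_def periodic_end)
  also have "\<dots> = 0" by (simp add: \<phi>_def v_bdry)
  finally have int: "integral ?Q (\<lambda>p. \<delta> * (\<phi> p)\<^sup>2) \<le> 0" .
  have \<delta>: "\<delta> > 0" using gap by (simp add: \<delta>_def)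
  obtain q where q: "q \<in> ?Q" "v q = v p" using x_periodic_box[OF L vper p] by metis
  have "\<delta> * (\<phi> q)\<^sup>2 = 0"
    using integral_nonpos_imp_zero[OF L ab cQ(1) _ int q(1)] \<delta> by simp
  moreover have "w q \<noteq> 0" using w0' q(1) cbox_subset_band by blast
  ultimately show ?thesis using \<delta> q(2) by (simp add: \<phi>_def)
qed

end

section \<open>Rigidity of travelling waves\<close>

locale travelling_wave_pair = vorticity_pair +
  assumes incompressible: "\<And>p. p \<in> band a b \<Longrightarrow> wx p + vy p = 0"
begin

text \<open>Proportionality makes the convective acceleration vanish, so fluid particles move on straight
  lines with constant velocity. A particle with \<open>v \<noteq> 0\<close> would hit the boundary.\<close>

lemma proportional_rigidity:
  assumes par: "\<And>p. p \<in> band a b \<Longrightarrow> w p * vx p = v p * wx p"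
      "\<And>p. p \<in> band a b \<Longrightarrow> w p * vy p = v p * wy p"
    and p: "p \<in> band a b"
  shows "v p = 0"
proof (rule ccontr)
  assume v0: "v p \<noteq> 0"
  obtain x0 y0 where p_eq: "p = (x0, y0)" by force
  define h k where "h = w p" and "k = v p"
  \<comment> \<open>The time at which the straight path with velocity \<open>(h, k)\<close> reaches
    the wall towards which \<open>k\<close> points.\<close>
  define T where "T = (if k > 0 then (b - y0) / k else (a - y0) / k)"
  have y0: "a \<le> y0" "y0 \<le> b" using p by (auto simp: p_eq)
  have k0: "k \<noteq> 0" using v0 by (simp add: k_def)
  have T0: "T \<ge> 0"
    using y0 k0 by (auto simp: T_def divide_nonneg_pos divide_nonpos_neg)
  have S: "y0 + t * k \<in> {a..b}" if t: "t \<in> {0..T}" for t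
  proof (cases "k > 0")
    case True
    then have "t * k \<le> b - y0" using t by (auto simp: T_def field_simps)
    moreover have "0 \<le> t * k" using t True by simp
    ultimately show ?thesis using y0 by auto
  next
    case False
    then have "k < 0" using k0 by simp
    then have "t * k \<ge> a - y0" using t by (auto simp: T_def field_simps)
    moreover have "t * k \<le> 0" using t \<open>k < 0\<close> by (simp add: mult_nonneg_nonpos)
    ultimately show ?thesis using y0 by auto
  qed
  define \<gamma> where "\<gamma> t = (x0 + t * h, y0 + t * k)" for t
  \<comment> \<open>The deviations of the velocity field on the straight path from the initial
    velocity. As \<open>(w, v)\<close> annihilates the gradients of \<open>w\<close> and
    \<open>v\<close>, differentiating along \<open>(h, k)\<close> leaves a linear homogeneous system
    for \<open>\<mu>\<close> and \<open>\<nu>\<close>, and zero initial data stay zero by a Gronwall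
    argument.\<close>
  define \<mu> where "\<mu> t = w (\<gamma> t) - h" for t
  define \<nu> where "\<nu> t = v (\<gamma> t) - k" for t
  have \<gamma>: "\<gamma> t \<in> band a b" if "t \<in> {0..T}" for t using S[OF that] by (simp add: \<gamma>_def)
  have "\<exists>K\<ge>0. \<forall>p\<in>band a b. \<bar>wx p\<bar> \<le> K \<and> \<bar>wy p\<bar> \<le> K \<and> \<bar>vx p\<bar> \<le> K \<and> \<bar>vy p\<bar> \<le> K"
  proof -
    define f where "f p = max (max \<bar>wx p\<bar> \<bar>wy p\<bar>) (max \<bar>vx p\<bar> \<bar>vy p\<bar>)" for p
    have "x_periodic L a b f" using wper' vper' by (auto simp: x_periodic_def f_def)
    moreover have "continuous_on (band a b) f" unfolding f_def by (intro continuous_intros wcont vcont)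
    ultimately obtain K where "K \<ge> 0" "\<And>p. p \<in> band a b \<Longrightarrow> \<bar>f p\<bar> \<le> K"
      by (rule bounded_on_band[OF L]) blast
    then show ?thesis by (intro exI[of _ K]) (auto simp: f_def)
  qed
  then obtain K where K: "K \<ge> 0" "\<And>p. p \<in> band a b \<Longrightarrow>
      \<bar>wx p\<bar> \<le> K \<and> \<bar>wy p\<bar> \<le> K \<and> \<bar>vx p\<bar> \<le> K \<and> \<bar>vy p\<bar> \<le> K" by blast
  define e where "e t = (\<mu> t)\<^sup>2 + (\<nu> t)\<^sup>2" for t
  define \<mu>' where "\<mu>' t = - (\<mu> t * wx (\<gamma> t)) - \<nu> t * wy (\<gamma> t)" for t
  define \<nu>' where "\<nu>' t = - (\<mu> t * vx (\<gamma> t)) - \<nu> t * vy (\<gamma> t)" for t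
  have d\<mu>: "(\<mu> has_real_derivative \<mu>' t) (at t within {0..T})" if t: "t \<in> {0..T}" for t
  proof -
    let ?p = "\<gamma> t"
    have "w ?p * wx ?p + v ?p * wy ?p = 0"
      using incompressible[OF \<gamma>[OF t]] par(2)[OF \<gamma>[OF t]] by (metis distrib_left mult_zero_right)
    then have "wx ?p * h + wy ?p * k = \<mu>' t" by (simp add: \<mu>'_def \<mu>_def \<nu>_def algebra_simps)
    then show ?thesis
      using DERIV_diff[OF C1_on_DERIV_line[OF w(1) S t] DERIV_const[of h], of x0 h]
      unfolding \<mu>_def \<gamma>_def by simp
  qed
  have d\<nu>: "(\<nu> has_real_derivative \<nu>' t) (at t within {0..T})" if t: "t \<in> {0..T}" for t
  proof -
    let ?p = "\<gamma> t"
    have "w ?p * vx ?p + v ?p * vy ?p = 0"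
      using incompressible[OF \<gamma>[OF t]] par(1)[OF \<gamma>[OF t]] by (metis distrib_left mult_zero_right)
    then have "vx ?p * h + vy ?p * k = \<nu>' t" by (simp add: \<nu>'_def \<mu>_def \<nu>_def algebra_simps)
    then show ?thesis
      using DERIV_diff[OF C1_on_DERIV_line[OF v(1) S t] DERIV_const[of k], of x0 h]
      unfolding \<nu>_def \<gamma>_def by simp
  qed
  have growth: "2 * \<mu> t * \<mu>' t + 2 * \<nu> t * \<nu>' t \<le> 4 * K * e t" if t: "t \<in> {0..T}" for t
  proof -
    have pr: "- (x * y * z) \<le> \<bar>x\<bar> * \<bar>y\<bar> * K" if "\<bar>z\<bar> \<le> K" for x y z :: real
    proof -
      have "- (x * y * z) \<le> \<bar>x\<bar> * \<bar>y\<bar> * \<bar>z\<bar>"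
        using abs_ge_minus_self[of "x * y * z"] by (simp add: abs_mult)
      also have "\<dots> \<le> \<bar>x\<bar> * \<bar>y\<bar> * K" using that by (intro mult_left_mono) auto
      finally show ?thesis .
    qed
    note Kt = K(2)[OF \<gamma>[OF t]]
    have "\<mu> t * \<mu>' t + \<nu> t * \<nu>' t
        \<le> \<bar>\<mu> t\<bar> * \<bar>\<mu> t\<bar> * K + \<bar>\<mu> t\<bar> * \<bar>\<nu> t\<bar> * K + (\<bar>\<nu> t\<bar> * \<bar>\<mu> t\<bar> * K + \<bar>\<nu> t\<bar> * \<bar>\<nu> t\<bar> * K)"
      using pr[of "wx (\<gamma> t)" "\<mu> t" "\<mu> t"] pr[of "wy (\<gamma> t)" "\<mu> t" "\<nu> t"]
        pr[of "vx (\<gamma> t)" "\<nu> t" "\<mu> t"] pr[of "vy (\<gamma> t)" "\<nu> t" "\<nu> t"] Kt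
      by (simp add: \<mu>'_def \<nu>'_def algebra_simps)
    also have "\<dots> = K * (\<bar>\<mu> t\<bar> + \<bar>\<nu> t\<bar>)\<^sup>2" by (simp add: power2_eq_square algebra_simps)
    also have "\<dots> \<le> K * (2 * e t)"
    proof (rule mult_left_mono[OF _ K(1)])
      have "0 \<le> (\<bar>\<mu> t\<bar> - \<bar>\<nu> t\<bar>)\<^sup>2" by simp
      then show "(\<bar>\<mu> t\<bar> + \<bar>\<nu> t\<bar>)\<^sup>2 \<le> 2 * e t" by (simp add: e_def power2_diff power2_sum)
    qed
    finally show ?thesis by simp
  qed
  have "((\<lambda>t. e t * exp (- (4 * K * t))) has_real_derivative
      ((2 * \<mu> t * \<mu>' t + 2 * \<nu> t * \<nu>' t) - 4 * K * e t) * exp (- (4 * K * t))) (at t within {0..T})"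
    if t: "t \<in> {0..T}" for t
    unfolding e_def by (auto intro!: derivative_eq_intros d\<mu>[OF t] d\<nu>[OF t] simp: algebra_simps)
  then have "\<exists>t\<in>{0..T}. e T * exp (- (4 * K * T)) - e 0 * exp (- (4 * K * 0))
      = ((2 * \<mu> t * \<mu>' t + 2 * \<nu> t * \<nu>' t) - 4 * K * e t) * exp (- (4 * K * t)) * (T - 0)"
    using T0 by (intro mvt_very_simple) (auto simp: has_field_derivative_def)
  then obtain t where t: "t \<in> {0..T}" "e T * exp (- (4 * K * T)) - e 0
      = ((2 * \<mu> t * \<mu>' t + 2 * \<nu> t * \<nu>' t) - 4 * K * e t) * exp (- (4 * K * t)) * T" by auto
  have "e 0 = 0" by (simp add: e_def \<mu>_def \<nu>_def \<gamma>_def h_def k_def p_eq)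
  moreover have "((2 * \<mu> t * \<mu>' t + 2 * \<nu> t * \<nu>' t) - 4 * K * e t) * exp (- (4 * K * t)) * T \<le> 0"
    using growth[OF t(1)] T0 by (intro mult_nonpos_nonneg) auto
  ultimately have "e T \<le> 0" 
    using t(2) mult_le_cancel_right_pos[of "exp (- (4 * K * T))" "e T" 0] by simp
  then have "\<nu> T = 0" unfolding e_def by (smt (verit) zero_le_power2 power2_eq_iff_nonneg zero_eq_power2)
  moreover have "y0 + T * k = a \<or> y0 + T * k = b" using k0 by (auto simp: T_def)
  then have "v (\<gamma> T) = 0" using v_bdry by (auto simp: \<gamma>_def)
  ultimately show False using k0 by (simp add: \<nu>_def)
qed

section \<open>Propagation of zeros between horizontal lines\<close>

lemma vy_eq_0:
  assumes y: "y \<in> {a..b}" and d: "d > 0" "\<And>z. z \<in> {a..b} \<Longrightarrow> \<bar>z - y\<bar> < d \<Longrightarrow> v (x, z) = 0"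
  shows "vy (x, y) = 0"
proof -
  have "((\<lambda>s. 0) has_real_derivative vy (x, y)) (at y within {a..b})"
    by (rule has_field_derivative_transform_within[OF dy_onD[OF vdy(1) y] d(1) y])
       (use d(2) in \<open>auto simp: dist_real_def\<close>)
  then show ?thesis
    by (intro vector_derivative_unique_within_closed_interval[of a b y "\<lambda>s. 0"])
       (use ab y in \<open>auto simp: has_real_derivative_iff_has_vector_derivative\<close>)
qed

text \<open>On the line \<open>wx = - vy = 0\<close>, so \<open>w\<close> is constant there. If the
  constant is nonzero, \<open>w\<close> stays away from zero nearby; if it is zero, the absence of
  critical points bounds \<open>wy\<close> away from zero. Either way \<open>\<bar>w\<bar>\<close>
  dominates a multiple of \<open>\<bar>y - y0\<bar>\<close>, so the potential in the equation for
  \<open>v\<close> is at most of Hardy type.\<close>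

lemma zero_near_line:
  assumes nocrit: "\<And>p. p \<in> band a b \<Longrightarrow> w p = 0 \<Longrightarrow> wx p \<noteq> 0 \<or> wy p \<noteq> 0"
    and y0: "y0 \<in> {a..b}" and line: "\<And>x. v (x, y0) = 0" "\<And>x. vy (x, y0) = 0"
  obtains \<eta> where "\<eta> > 0" "\<And>x y. y \<in> {a..b} \<Longrightarrow> \<bar>y - y0\<bar> \<le> \<eta> \<Longrightarrow> v (x, y) = 0"
proof -
  have wx0: "wx (x, y0) = 0" for x
    using incompressible[of "(x, y0)"] line(2) y0 by simp
  have wline: "w (x, y0) = w (0, y0)" for x
  proof -
    have "((\<lambda>s. w (s, y0)) has_real_derivative 0) (at x)" for x
      using dx_onD[OF wdx(1) y0, of x] by (simp add: wx0)
    then show ?thesis using DERIV_isconst_all by blast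
  qed
  have "\<exists>\<alpha>>0. \<exists>\<eta>>0. \<forall>x. \<forall>y\<in>{a..b}. \<bar>y - y0\<bar> \<le> \<eta> \<longrightarrow> \<alpha> * \<bar>y - y0\<bar> \<le> \<bar>w (x, y)\<bar>"
  proof (cases "w (0, y0) = 0")
    case False
    obtain K where K: "K \<ge> 0" "\<And>p. p \<in> band a b \<Longrightarrow> \<bar>wy p\<bar> \<le> K"
      using bounded_on_band[OF L wper'(3) wcont(3)] by blast
    define \<alpha> where "\<alpha> = \<bar>w (0, y0)\<bar> / 2"
    \<comment> \<open>Within this distance \<open>w\<close> changes by at most half of its absolute
      value on the line, and \<open>\<eta> \<le> 1\<close> turns the constant lower bound into a
      linear one.\<close>
    define \<eta> where "\<eta> = min 1 (\<alpha> / (K + 1))"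
    have \<alpha>: "\<alpha> > 0" using False by (simp add: \<alpha>_def)
    have "\<eta> \<le> \<alpha> / (K + 1)" by (simp add: \<eta>_def)
    then have "(K + 1) * \<eta> \<le> \<alpha>" using K(1) by (simp add: pos_le_divide_eq mult.commute)
    moreover have "\<eta> > 0" "\<eta> \<le> 1" using \<alpha> K(1) by (auto simp: \<eta>_def)
    ultimately have \<eta>: "\<eta> > 0" "\<eta> \<le> 1" "(K + 1) * \<eta> \<le> \<alpha>" by auto
    have "\<alpha> * \<bar>y - y0\<bar> \<le> \<bar>w (x, y)\<bar>" if y: "y \<in> {a..b}" "\<bar>y - y0\<bar> \<le> \<eta>" for x y
    proof -
      obtain z where z: "z \<in> {a..b}" "w (x, y) - w (x, y0) = wy (x, z) * (y - y0)"
        using dy_on_mvt_near[OF wdy(1) y0 y(1)] by metis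
      have "\<bar>wy (x, z) * (y - y0)\<bar> \<le> (K + 1) * \<eta>"
        unfolding abs_mult using K(1) K(2)[of "(x, z)"] z(1) y(2) by (intro mult_mono) auto
      then have "\<alpha> \<le> \<bar>w (x, y)\<bar>"
        using z(2) \<eta>(3) wline[of x] unfolding \<alpha>_def by argo
      moreover have "\<alpha> * \<bar>y - y0\<bar> \<le> \<alpha> * 1" using \<alpha> y(2) \<eta>(2) by (intro mult_left_mono) auto
      ultimately show ?thesis by simp
    qed
    then show ?thesis using \<alpha> \<eta>(1) by blast
  next
    case True
    obtain K where K: "K \<ge> 0" "\<And>p. p \<in> band a b \<Longrightarrow> \<bar>wyy p\<bar> \<le> K"
      using bounded_on_band[OF L wper''(2) wcont(7)] by blast
    have "continuous_on {0..L} (\<lambda>x. \<bar>wy (x, y0)\<bar>)"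
      using y0 by (intro continuous_intros continuous_on_compose2[OF wcont(3)]) auto
    then have "\<exists>x1\<in>{0..L}. \<forall>x\<in>{0..L}. \<bar>wy (x1, y0)\<bar> \<le> \<bar>wy (x, y0)\<bar>"
      using L by (intro continuous_attains_inf) auto
    then obtain x1 where x1: "\<And>x. x \<in> {0..L} \<Longrightarrow> \<bar>wy (x1, y0)\<bar> \<le> \<bar>wy (x, y0)\<bar>" by blast
    define \<alpha> where "\<alpha> = \<bar>wy (x1, y0)\<bar> / 2"
    have "w (x1, y0) = 0" using wline True by metis
    then have \<alpha>: "\<alpha> > 0" using nocrit[of "(x1, y0)"] wx0 y0 by (simp add: \<alpha>_def)
    have wy_ge: "2 * \<alpha> \<le> \<bar>wy (x, y0)\<bar>" for x
    proof -
      \<comment> \<open>The degenerate band consisting of the single line carries the minimum over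
        one period to all \<open>x\<close>.\<close>
      have per: "x_periodic L y0 y0 wy" using wper'(3) y0 by (auto simp: x_periodic_def)
      obtain q where "q \<in> cbox (0, y0) (L, y0)" "wy q = wy (x, y0)"
        using x_periodic_box[OF L per, of "(x, y0)"] by auto
      then show ?thesis using x1[of "fst q"] by (cases q) (auto simp: \<alpha>_def)
    qed
    \<comment> \<open>Within this distance \<open>wy\<close> changes by at most \<alpha>, so its
      absolute value, at least \<open>2 * \<alpha>\<close> on the line, stays above
      \<alpha>.\<close>
    define \<eta> where "\<eta> = \<alpha> / (K + 1)"
    have \<eta>: "\<eta> > 0" "(K + 1) * \<eta> = \<alpha>"
      using \<alpha> K(1) by (auto simp: \<eta>_def field_simps)
    have "\<alpha> * \<bar>y - y0\<bar> \<le> \<bar>w (x, y)\<bar>" if y: "y \<in> {a..b}" "\<bar>y - y0\<bar> \<le> \<eta>" for x y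
    proof -
      obtain z where z: "z \<in> {a..b}" "\<bar>z - y0\<bar> \<le> \<bar>y - y0\<bar>" "w (x, y) - w (x, y0) = wy (x, z) * (y - y0)"
        using dy_on_mvt_near[OF wdy(1) y0 y(1)] by metis
      obtain z' where z': "z' \<in> {a..b}" "wy (x, z) - wy (x, y0) = wyy (x, z') * (z - y0)"
        using dy_on_mvt_near[OF wdy(3) y0 z(1)] by metis
      have "\<bar>wyy (x, z') * (z - y0)\<bar> \<le> (K + 1) * \<eta>"
        unfolding abs_mult using K(1) K(2)[of "(x, z')"] z'(1) z(2) y(2) by (intro mult_mono) auto
      then have "\<alpha> \<le> \<bar>wy (x, z)\<bar>" using z'(2) wy_ge[of x] \<eta>(2) by argo
      then have "\<alpha> * \<bar>y - y0\<bar> \<le> \<bar>wy (x, z)\<bar> * \<bar>y - y0\<bar>" by (rule mult_right_mono) simp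
      also have "\<dots> = \<bar>w (x, y)\<bar>" using z(3) wline[of x] True by (simp add: abs_mult)
      finally show ?thesis .
    qed
    then show ?thesis using \<alpha> \<eta>(1) by blast
  qed
  then obtain \<alpha> \<eta> where \<alpha>: "\<alpha> > 0" and \<eta>: "\<eta> > 0" and
    w_ge: "\<And>x y. y \<in> {a..b} \<Longrightarrow> \<bar>y - y0\<bar> \<le> \<eta> \<Longrightarrow> \<alpha> * \<bar>y - y0\<bar> \<le> \<bar>w (x, y)\<bar>" by blast
  have "x_periodic L a b (\<lambda>p. \<beta> - (wxx p + wyy p))" using wper'' by (auto simp: x_periodic_def)
  moreover have "continuous_on (band a b) (\<lambda>p. \<beta> - (wxx p + wyy p))" by (intro continuous_intros wcont)
  ultimately obtain K where K: "K \<ge> 0" "\<And>p. p \<in> band a b \<Longrightarrow> \<bar>\<beta> - (wxx p + wyy p)\<bar> \<le> K"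
    by (rule bounded_on_band[OF L]) blast
  define C where "C = K / \<alpha>"
  have C: "C \<ge> 0" using K(1) \<alpha> by (simp add: C_def)
  have lap: "\<bar>y - y0\<bar> * \<bar>vxx (x, y) + vyy (x, y)\<bar> \<le> C * \<bar>v (x, y)\<bar>"
    if y: "y \<in> {a..b}" "\<bar>y - y0\<bar> \<le> \<eta>" for x y
  proof -
    let ?p = "(x, y)"
    have pb: "?p \<in> band a b" using y by simp
    have "w ?p * (vxx ?p + vyy ?p) = - ((\<beta> - (wxx ?p + wyy ?p)) * v ?p)"
      using vorticity[OF pb] by simp
    then have e: "\<bar>w ?p\<bar> * \<bar>vxx ?p + vyy ?p\<bar> = \<bar>\<beta> - (wxx ?p + wyy ?p)\<bar> * \<bar>v ?p\<bar>"
      by (metis abs_minus_cancel abs_mult)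
    have "\<alpha> * \<bar>y - y0\<bar> * \<bar>vxx ?p + vyy ?p\<bar> \<le> \<bar>w ?p\<bar> * \<bar>vxx ?p + vyy ?p\<bar>"
      using w_ge[OF y] by (rule mult_right_mono) simp
    also have "\<dots> \<le> K * \<bar>v ?p\<bar>" unfolding e using K(2)[OF pb] by (rule mult_right_mono) simp
    finally show ?thesis using \<alpha> by (simp add: C_def field_simps)
  qed
  have "v (x, y) = 0" if y: "y \<in> {a..b}" "\<bar>y - y0\<bar> \<le> \<eta>" for x y
  proof -
    obtain q where q: "q \<in> cbox (0, y) (L, y)" "v q = v (x, y)"
      using x_periodic_box[OF L, of y y v "(x, y)"] vper y by (auto simp: x_periodic_def)
    consider "y = y0" | "y > y0" | "y < y0" by linarith
    then have "v q = 0"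
    proof cases
      case 1
      then show ?thesis using q line by simp
    next
      case 2
      show ?thesis
      proof (rule strip_unique_continuation[OF L 2])
        show "C1_on y0 y v vx vy" "C1_on y0 y vx vxx vxy" "C1_on y0 y vy vxy vyy"
          by (rule C1_on_subset[OF v(1)] C1_on_subset[OF v(2)] C1_on_subset[OF v(3)]; use y0 y in simp)+
        show "q \<in> cbox (0, y0) (L, y)" using q(1) 2 by (cases q) auto
        show "(s - y0) * \<bar>vxx (x, s) + vyy (x, s)\<bar> \<le> C * \<bar>v (x, s)\<bar>" if "s \<in> {y0..y}" for x s
          using lap[of s x] that y y0 by auto
      qed (use line C periodic_end y y0 in auto)
    next
      case 3
      \<comment> \<open>After reflection the line \<open>y0\<close> becomes the lower edge of the
        strip from \<open>- y0\<close> to \<open>- y\<close>.\<close>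
      have "v (fst (fst q, - snd q), - snd (fst q, - snd q)) = 0"
      proof (rule strip_unique_continuation[where a = "- y0" and b = "- y" and C = C
            and p = "(fst q, - snd q)" and v = "\<lambda>p. v (fst p, - snd p)"
            and vx = "\<lambda>p. vx (fst p, - snd p)" and vy = "\<lambda>p. - vy (fst p, - snd p)"
            and vxx = "\<lambda>p. vxx (fst p, - snd p)" and vxy = "\<lambda>p. - vxy (fst p, - snd p)"
            and vyy = "\<lambda>p. vyy (fst p, - snd p)", OF L])
        show "- y0 < - y" using 3 by simp
        have r: "C1_on (- y0) (- y) f fx fy" if "C1_on (- b) (- a) f fx fy" for f fx fy
          by (rule C1_on_subset[OF that]) (use y y0 in auto)
        show "C1_on (- y0) (- y) (\<lambda>p. v (fst p, - snd p)) (\<lambda>p. vx (fst p, - snd p)) (\<lambda>p. - vy (fst p, - snd p))"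
          by (rule r[OF C1_on_reflect[OF v(1)]])
        show "C1_on (- y0) (- y) (\<lambda>p. vx (fst p, - snd p)) (\<lambda>p. vxx (fst p, - snd p)) (\<lambda>p. - vxy (fst p, - snd p))"
          by (rule r[OF C1_on_reflect[OF v(2)]])
        have "C1_on (- b) (- a) (\<lambda>p. - vy (fst p, - snd p)) (\<lambda>p. - vxy (fst p, - snd p)) (\<lambda>p. vyy (fst p, - snd p))"
          using C1_on_minus[OF C1_on_reflect[OF v(3)]] by simp
        then show "C1_on (- y0) (- y) (\<lambda>p. - vy (fst p, - snd p)) (\<lambda>p. - vxy (fst p, - snd p)) (\<lambda>p. vyy (fst p, - snd p))"
          by (rule r)
        show "(fst q, - snd q) \<in> cbox (0, - y0) (L, - y)" using q(1) 3 by (cases q) auto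
        show "(s - - y0) * \<bar>vxx (fst (x, s), - snd (x, s)) + vyy (fst (x, s), - snd (x, s))\<bar>
            \<le> C * \<bar>v (fst (x, s), - snd (x, s))\<bar>" if "s \<in> {- y0..- y}" for x s
          using lap[of "- s" x] that y y0 by (auto simp: add.commute)
      qed (use line C periodic_end y y0 in auto)
      then show ?thesis by simp
    qed
    then show ?thesis using q(2) by simp
  qed
  then show ?thesis using \<eta> by (intro that[of \<eta>]) auto
qed

text \<open>The set of \<open>y\<close> at which \<open>v\<close> and \<open>v\<^sub>y\<close> vanish on the whole horizontal line is closed, and it is
  open by unique continuation.\<close>

lemma zero_on_line_imp_zero:
  assumes nocrit: "\<And>p. p \<in> band a b \<Longrightarrow> w p = 0 \<Longrightarrow> wx p \<noteq> 0 \<or> wy p \<noteq> 0"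
    and y0: "y0 \<in> {a..b}" and line: "\<And>x. v (x, y0) = 0" "\<And>x. vy (x, y0) = 0"
    and p: "p \<in> band a b"
  shows "v p = 0"
proof -
  define S where "S = {y \<in> {a..b}. \<forall>x. v (x, y) = 0 \<and> vy (x, y) = 0}"
  have "openin (top_of_set {a..b}) S"
    unfolding openin_euclidean_subtopology_iff
  proof (intro conjI ballI)
    fix y assume "y \<in> S"
    then have y: "y \<in> {a..b}" "\<And>x. v (x, y) = 0" "\<And>x. vy (x, y) = 0" by (auto simp: S_def)
    obtain \<eta> where \<eta>: "\<eta> > 0" "\<And>x z. z \<in> {a..b} \<Longrightarrow> \<bar>z - y\<bar> \<le> \<eta> \<Longrightarrow> v (x, z) = 0"
      using zero_near_line[OF nocrit y] by metis
    have "z \<in> S" if z: "z \<in> {a..b}" "dist z y < \<eta>" for z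
    proof -
      have "vy (x, z) = 0" for x
        by (rule vy_eq_0[OF z(1), of "\<eta> - dist z y"]) (use z \<eta>(2) in \<open>auto simp: dist_real_def\<close>)
      then show ?thesis using z \<eta>(2) by (auto simp: S_def dist_real_def)
    qed
    then show "\<exists>e>0. \<forall>x'\<in>{a..b}. dist x' y < e \<longrightarrow> x' \<in> S" using \<eta>(1) by blast
  qed (auto simp: S_def)
  moreover have "closedin (top_of_set {a..b}) S"
  proof -
    have "closed {y \<in> {a..b}. f (x, y) = 0}" if "continuous_on (band a b) f" for f :: "real \<times> real \<Rightarrow> real" and x
    proof (rule continuous_closed_preimage_constant)
      show "continuous_on {a..b} (\<lambda>y. f (x, y))"
        by (rule continuous_on_compose2[OF that]) (auto intro!: continuous_intros)
    qed simp
    then have "closed (\<Inter>x. {y \<in> {a..b}. v (x, y) = 0} \<inter> {y \<in> {a..b}. vy (x, y) = 0})"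
      using vcont by (intro closed_INT ballI closed_Int) auto
    moreover have "(\<Inter>x. {y \<in> {a..b}. v (x, y) = 0} \<inter> {y \<in> {a..b}. vy (x, y) = 0}) = S"
      by (auto simp: S_def)
    ultimately have "closed S" by simp
    then show ?thesis by (intro closed_subset) (auto simp: S_def)
  qed
  moreover have "y0 \<in> S" using y0 line by (simp add: S_def)
  ultimately have "S = {a..b}"
    using connected_clopen[of "{a..b}"] connected_Icc by blast
  then show ?thesis using p by (cases p) (auto simp: S_def)
qed

text \<open>On \<open>{w < 0}\<close> the energy estimate gives \<open>v = 0\<close>, hence \<open>w\<^sub>x = - v\<^sub>y = 0\<close>; thus this set consists of
  full horizontal lines, from which \<open>v = 0\<close> propagates.\<close>

lemma negative_value_rigidity:
  assumes "\<beta> > 0"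
    and noinfl: "\<And>p. p \<in> band a b \<Longrightarrow> w p = 0 \<Longrightarrow> \<beta> - (wxx p + wyy p) \<noteq> 0"
    and nocrit: "\<And>p. p \<in> band a b \<Longrightarrow> w p = 0 \<Longrightarrow> wx p \<noteq> 0 \<or> wy p \<noteq> 0"
    and p0: "p0 \<in> band a b" "w p0 < 0"
    and p: "p \<in> band a b"
  shows "v p = 0"
proof -
  obtain C where C: "C \<ge> 0" "\<And>p. p \<in> band a b \<Longrightarrow> \<bar>v p\<bar> \<le> C * \<bar>w p\<bar>"
    using v_le_w[OF noinfl] by metis
  have v0: "v p = 0" if "p \<in> band a b" "w p < 0" for p
    using negative_region(3)[OF C that] \<open>\<beta> > 0\<close> by simp
  have vy0: "vy (x, y) = 0" if y: "y \<in> {a..b}" "w (x, y) < 0" for x y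
  proof -
    have "continuous_on {a..b} (\<lambda>y. w (x, y))"
      by (rule continuous_on_compose2[OF wcont(1)]) (auto intro!: continuous_intros)
    then obtain d where d: "d > 0" "\<And>z. z \<in> {a..b} \<Longrightarrow> \<bar>z - y\<bar> < d \<Longrightarrow> \<bar>w (x, z) - w (x, y)\<bar> < - w (x, y)"
      using y unfolding continuous_on_iff dist_real_def by (metis neg_0_less_iff_less)
    show ?thesis
    proof (rule vy_eq_0[OF y(1) d(1)])
      fix z assume z: "z \<in> {a..b}" "\<bar>z - y\<bar> < d"
      have "w (x, z) < 0" using d(2)[OF z] by linarith
      then show "v (x, z) = 0" using z by (intro v0) auto
    qed
  qed
  obtain x0 y0 where p0_eq: "p0 = (x0, y0)" by force
  have y0: "y0 \<in> {a..b}" using p0(1) by (simp add: p0_eq)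
  \<comment> \<open>Where \<open>w < 0\<close>, \<open>wx = - vy = 0\<close>; elsewhere the factor
    \<open>min w 0\<close> vanishes. So the squared negative part is constant along the line, and
    negativity at \<open>x0\<close> spreads to the whole line.\<close>
  have "((\<lambda>x. (min (w (x, y0)) 0)\<^sup>2) has_real_derivative 0) (at x)" for x
  proof -
    have "((\<lambda>x. (min (w (x, y0)) 0)\<^sup>2) has_real_derivative 2 * min (w (x, y0)) 0 * wx (x, y0)) (at x)"
      using DERIV_chain2[OF DERIV_min_zero_power[of 0] dx_onD[OF wdx(1) y0]]
      by (simp add: numeral_2_eq_2)
    moreover have "2 * min (w (x, y0)) 0 * wx (x, y0) = 0"
      using vy0[OF y0, of x] incompressible[of "(x, y0)"] y0 by (cases "w (x, y0) < 0") auto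
    ultimately show ?thesis by simp
  qed
  then have const: "(min (w (x, y0)) 0)\<^sup>2 = (min (w (x0, y0)) 0)\<^sup>2" for x
    using DERIV_isconst_all by blast
  have neg: "w (x, y0) < 0" for x
  proof -
    have "min (w (x, y0)) 0 \<noteq> 0" using const[of x] p0(2) by (auto simp: p0_eq)
    then show ?thesis by (auto simp: min_def split: if_splits)
  qed
  show ?thesis
    using zero_on_line_imp_zero[OF nocrit y0 _ _ p] v0 vy0 neg y0 by auto
qed

end

section \<open>The vorticity equation\<close>

text \<open>The vorticity equation \<open>(u - c) \<Delta>v + (\<beta> - \<Delta>u) v = 0\<close> is the curl of the momentum equations.
  The pressure is only assumed to be \<open>C\<^sup>1\<close>; its gradient is \<open>C\<^sup>1\<close> because of the momentum equations.\<close>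

lemma travelling_wave_vorticity:
  assumes ab: "dm < dp" and u: "C2_band dm dp u" and v: "C2_band dm dp v"
    and tw: "traveling_wave L dm dp f0 \<beta> c u v"
    and p: "p \<in> band dm dp"
  shows "pd_x u p + pd_y dm dp v p = 0"
    and "v (x, dm) = 0" and "v (x, dp) = 0"
    and "(u p - c) * (pd_x (pd_x v) p + pd_y dm dp (pd_y dm dp v) p)
      + (\<beta> - (pd_x (pd_x u) p + pd_y dm dp (pd_y dm dp u) p)) * v p = 0"
proof -
  obtain P where sol: "beta_plane_solution L dm dp f0 \<beta>
      (\<lambda>t (x, y). u (x - c * t, y)) (\<lambda>t (x, y). v (x - c * t, y)) P"
    using tw unfolding traveling_wave_def by blast
  define ux uy vx vy where defs: "ux = pd_x u" "uy = pd_y dm dp u" "vx = pd_x v" "vy = pd_y dm dp v"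
  define uxx uxy uyx uyy where defs2: "uxx = pd_x ux" "uxy = pd_y dm dp ux" "uyx = pd_x uy" "uyy = pd_y dm dp uy"
  define vxx vxy vyx vyy where defs3: "vxx = pd_x vx" "vxy = pd_y dm dp vx" "vyx = pd_x vy" "vyy = pd_y dm dp vy"
  have U: "C1_on dm dp u ux uy" "C1_on dm dp ux uxx uxy" "C1_on dm dp uy uyx uyy"
    using u unfolding C2_band_def defs defs2 by (auto intro: C1_band_C1_on)
  have V: "C1_on dm dp v vx vy" "C1_on dm dp vx vxx vxy" "C1_on dm dp vy vyx vyy"
    using v unfolding C2_band_def defs defs3 by (auto intro: C1_band_C1_on)
  note dx = C1_onD(1)[OF U(1)] C1_onD(1)[OF U(2)] C1_onD(1)[OF U(3)]
    C1_onD(1)[OF V(1)] C1_onD(1)[OF V(2)] C1_onD(1)[OF V(3)]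
  note dy = C1_onD(2)[OF U(1)] C1_onD(2)[OF U(2)] C1_onD(2)[OF U(3)]
    C1_onD(2)[OF V(1)] C1_onD(2)[OF V(2)] C1_onD(2)[OF V(3)]
  note cont = C1_onD(3-5)[OF U(1)] C1_onD(4-5)[OF U(2)] C1_onD(4-5)[OF U(3)]
    C1_onD(3-5)[OF V(1)] C1_onD(4-5)[OF V(2)] C1_onD(4-5)[OF V(3)]
  define Px Py where "Px = pd_x (P 0)" and "Py = pd_y dm dp (P 0)"
  have P: "C1_on dm dp (P 0) Px Py"
    using sol unfolding beta_plane_solution_def Px_def Py_def by (auto intro: C1_band_C1_on)
  \<comment> \<open>The equations are evaluated at time zero only, where the time derivative of the
    travelling profile is \<open>- c\<close> times its \<open>x\<close>-derivative.\<close>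
  have dt: "deriv (\<lambda>s. f (x - c * s, y)) 0 = - c * fx (x, y)"
    if "dx_on dm dp f fx" "y \<in> {dm..dp}" for f fx x y
  proof (rule DERIV_imp_deriv)
    have "((\<lambda>s. x - c * s) has_real_derivative - c) (at 0)" by (auto intro!: derivative_eq_intros)
    then have "((\<lambda>s. f (x - c * s, y)) has_real_derivative fx (x - c * 0, y) * - c) (at 0)"
      by (rule DERIV_chain2[OF dx_onD[OF that]])
    then show "((\<lambda>s. f (x - c * s, y)) has_real_derivative - c * fx (x, y)) (at 0)"
      by (simp add: mult.commute)
  qed
  have eqs: "Px (x, y) = - ((u (x, y) - c) * ux (x, y) + v (x, y) * uy (x, y) - (f0 + \<beta> * y) * v (x, y))"
      "Py (x, y) = - ((u (x, y) - c) * vx (x, y) + v (x, y) * vy (x, y) + (f0 + \<beta> * y) * u (x, y))"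
      "ux (x, y) + vy (x, y) = 0" if y: "y \<in> {dm..dp}" for x y
  proof -
    have s: "(\<lambda>(x, y). f (x - c * 0, y)) = f" for f :: "real \<times> real \<Rightarrow> real" by auto
    note momentum = sol[unfolded beta_plane_solution_def, THEN conjunct2, THEN conjunct1, rule_format,
        OF y, of x 0]
    have "deriv (\<lambda>s. u (x - c * s, y)) 0 + u (x, y) * ux (x, y) + v (x, y) * uy (x, y)
        - (f0 + \<beta> * y) * v (x, y) = - Px (x, y)"
      "deriv (\<lambda>s. v (x - c * s, y)) 0 + u (x, y) * vx (x, y) + v (x, y) * vy (x, y)
        + (f0 + \<beta> * y) * u (x, y) = - Py (x, y)" and div: "ux (x, y) + vy (x, y) = 0"
      using momentum by (simp_all add: s defs Px_def Py_def)
    then show "Px (x, y) = - ((u (x, y) - c) * ux (x, y) + v (x, y) * uy (x, y) - (f0 + \<beta> * y) * v (x, y))"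
      "Py (x, y) = - ((u (x, y) - c) * vx (x, y) + v (x, y) * vy (x, y) + (f0 + \<beta> * y) * u (x, y))"
      unfolding dt[OF dx(1) y] dt[OF dx(4) y] by (auto simp: algebra_simps)
    show "ux (x, y) + vy (x, y) = 0" by fact
  qed
  show div: "pd_x u p + pd_y dm dp v p = 0"
    using eqs(3)[of "snd p" "fst p"] p unfolding defs by (cases p) auto
  show "v (x, dm) = 0" "v (x, dp) = 0"
    using sol[unfolded beta_plane_solution_def, THEN conjunct2, THEN conjunct2, rule_format, of 0 x]
    by simp_all
  define Pxy where "Pxy q = - (uy q * ux q + (u q - c) * uxy q + vy q * uy q + v q * uyy q
      - \<beta> * v q - (f0 + \<beta> * snd q) * vy q)" for q
  define Pyx where "Pyx q = - (ux q * vx q + (u q - c) * vxx q + vx q * vy q + v q * vyx q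
      + (f0 + \<beta> * snd q) * ux q)" for q
  have dPx: "dy_on dm dp Px Pxy"
    unfolding dy_on_def
  proof (intro allI ballI)
    fix x y assume y: "y \<in> {dm..dp}"
    have "((\<lambda>y. - ((u (x, y) - c) * ux (x, y) + v (x, y) * uy (x, y) - (f0 + \<beta> * y) * v (x, y)))
        has_real_derivative Pxy (x, y)) (at y within {dm..dp})"
      unfolding Pxy_def
      by (auto intro!: derivative_eq_intros dy_onD[OF dy(1) y] dy_onD[OF dy(2) y] dy_onD[OF dy(3) y]
          dy_onD[OF dy(4) y] simp: algebra_simps)
    then show "((\<lambda>s. Px (x, s)) has_real_derivative Pxy (x, y)) (at y within {dm..dp})"
      by (rule has_field_derivative_transform_within[of _ _ _ _ 1]) (use y eqs(1) in auto)
  qed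
  have dPy: "dx_on dm dp Py Pyx"
    unfolding dx_on_def
  proof (intro allI ballI)
    fix x y assume y: "y \<in> {dm..dp}"
    have "((\<lambda>x. - ((u (x, y) - c) * vx (x, y) + v (x, y) * vy (x, y) + (f0 + \<beta> * y) * u (x, y)))
        has_real_derivative Pyx (x, y)) (at x)"
      unfolding Pyx_def
      by (auto intro!: derivative_eq_intros dx_onD[OF dx(1) y] dx_onD[OF dx(4) y] dx_onD[OF dx(5) y]
          dx_onD[OF dx(6) y] simp: algebra_simps)
    then show "((\<lambda>s. Py (s, y)) has_real_derivative Pyx (x, y)) (at x)"
      using eqs(2)[OF y] by simp
  qed
  have "continuous_on (band dm dp) Pxy" "continuous_on (band dm dp) Pyx"
    unfolding Pxy_def Pyx_def by (intro continuous_intros cont)+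
  then have curl: "Pxy p = Pyx p"
    by (rule mixed_partials_eq[OF ab C1_onD(1,2)[OF P] dPx dPy _ _ p])
  have neg: "ux q = - vy q" if "q \<in> band dm dp" for q
    using eqs(3)[of "snd q" "fst q"] that by (cases q) auto
  \<comment> \<open>Incompressibility and its two first derivatives enter the curl: the products of
    first derivatives and the terms with \<open>f0 + \<beta> * y\<close> cancel, and
    \<open>\<beta> * v\<close> remains from the gradient of the Coriolis parameter.\<close>
  have "uxy p = - vyy p"
  proof (rule dy_on_unique[OF ab dy(2) _ neg p])
    show "dy_on dm dp (\<lambda>q. - vy q) (\<lambda>q. - vyy q)"
      using dy(6) by (auto simp: dy_on_def intro: DERIV_minus)
  qed
  moreover have "vyx p = - uxx p"
  proof -
    have "uxx p = - vyx p"
    proof (rule dx_on_unique[OF dx(2) _ neg p])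
      show "dx_on dm dp (\<lambda>q. - vy q) (\<lambda>q. - vyx q)"
        using dx(6) by (auto simp: dx_on_def intro: DERIV_minus)
    qed
    then show ?thesis by simp
  qed
  moreover note neg[OF p]
  ultimately have "(u p - c) * (vxx p + vyy p) + (\<beta> - (uxx p + uyy p)) * v p = 0"
    using curl unfolding Pxy_def Pyx_def by (simp add: algebra_simps)
  then show "(u p - c) * (pd_x (pd_x v) p + pd_y dm dp (pd_y dm dp v) p)
      + (\<beta> - (pd_x (pd_x u) p + pd_y dm dp (pd_y dm dp u) p)) * v p = 0"
    by (simp add: defs defs2 defs3)
qed

section \<open>The threshold speed and the case distinction\<close>

text \<open>With \<open>q = pi\<^sup>2 / D\<^sup>2\<close>, the left side of the last hypothesis is
  the larger root of \<open>q * m\<^sup>2 - \<beta> * m - \<beta> * R\<close>. Beyond it the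
  quadratic is positive, which is the condition \<open>large\<close> of
  \<open>positive_rigidity\<close> for \<open>w\<close> ranging from \<open>m\<close> to
  \<open>m + R\<close>.\<close>

lemma c_beta_plus_quadratic:
  fixes m R \<beta> D :: real
  assumes D: "D > 0" and "\<beta> > 0" "R \<ge> 0"
    and m: "\<beta> * D\<^sup>2 / (2 * pi\<^sup>2) + D\<^sup>2 / (2 * pi\<^sup>2) * sqrt (\<beta>\<^sup>2 + 4 * pi\<^sup>2 * \<beta> / D\<^sup>2 * R) < m"
  shows "m > 0" "\<beta> * (m + R) < (m * (pi / D))\<^sup>2"
proof -
  define q where "q = pi\<^sup>2 / D\<^sup>2"
  have q: "q > 0" using D by (simp add: q_def)
  define s where "s = sqrt (\<beta>\<^sup>2 + 4 * q * \<beta> * R)"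
  have arg: "0 \<le> \<beta>\<^sup>2 + 4 * q * \<beta> * R" using assms q by simp
  have s0: "s \<ge> 0" using arg by (simp add: s_def)
  have "D\<^sup>2 / (2 * pi\<^sup>2) = 1 / (2 * q)" by (simp add: q_def)
  moreover have "\<beta> * D\<^sup>2 / (2 * pi\<^sup>2) = \<beta> / (2 * q)" by (simp add: q_def)
  moreover have "4 * pi\<^sup>2 * \<beta> / D\<^sup>2 * R = 4 * q * \<beta> * R" by (simp add: q_def)
  ultimately have "\<beta> / (2 * q) + 1 / (2 * q) * s < m" using m by (simp add: s_def)
  then have "\<beta> + s < m * (2 * q)" using q by (simp add: field_simps)
  then have lt: "s < 2 * q * m - \<beta>" by (simp add: mult_ac)
  then have "0 < 2 * q * m" using s0 \<open>\<beta> > 0\<close> by linarith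
  then show "m > 0" using q by (simp add: zero_less_mult_iff)
  have "s\<^sup>2 < (2 * q * m - \<beta>)\<^sup>2" using lt s0 by (intro power_strict_mono) auto
  then have "\<beta>\<^sup>2 + 4 * q * \<beta> * R < (2 * q * m - \<beta>)\<^sup>2" using arg by (simp add: s_def)
  then have "4 * q * (\<beta> * (m + R)) < 4 * q * (q * m\<^sup>2)" by (simp add: power2_eq_square algebra_simps)
  then have "\<beta> * (m + R) < q * m\<^sup>2" using q by simp
  then show "\<beta> * (m + R) < (m * (pi / D))\<^sup>2" by (simp add: q_def power_mult_distrib power_divide mult_ac)
qed

theorem theorem1p1:
  fixes L dm dp f0 \<beta> c :: real and u v :: "real \<times> real \<Rightarrow> real"
  assumes "L > 0" and "dm < dp" and "\<beta> \<ge> 0"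
    and "x_periodic L dm dp u" and "x_periodic L dm dp v"
    and "C2_band dm dp u" and "C2_band dm dp v"
    and "traveling_wave L dm dp f0 \<beta> c u v"
    and "\<not> shear_flow dm dp v"
  shows "(\<beta> > 0 \<longrightarrow>
            {p \<in> band dm dp. \<beta> - laplacian dm dp u p = 0} \<inter> {p \<in> band dm dp. u p = c} \<noteq> {} \<or>
            {p \<in> band dm dp. gradient dm dp u p = 0} \<inter> {p \<in> band dm dp. u p = c} \<noteq> {} \<or>
            c \<in> {band_max dm dp u, band_min dm dp u} \<or>
            (c \<notin> u ` band dm dp \<and> c \<in> {c_beta_plus dm dp \<beta> u..<band_min dm dp u})) \<and>
         (\<beta> = 0 \<longrightarrow>
            {p \<in> band dm dp. laplacian dm dp u p = 0} \<inter> {p \<in> band dm dp. u p = c} \<noteq> {})"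
proof -
  define w where "w p = u p - c" for p
  let ?B = "band dm dp"
  let ?ux = "pd_x u" and ?uy = "pd_y dm dp u" and ?vx = "pd_x v" and ?vy = "pd_y dm dp v"
  note tw = travelling_wave_vorticity[OF assms(2,6,7,8)]
  have U: "C1_on dm dp u ?ux ?uy" "C1_on dm dp ?ux (pd_x ?ux) (pd_y dm dp ?ux)"
    "C1_on dm dp ?uy (pd_x ?uy) (pd_y dm dp ?uy)"
    using assms(6) unfolding C2_band_def by (auto intro: C1_band_C1_on)
  have V: "C1_on dm dp v ?vx ?vy" "C1_on dm dp ?vx (pd_x ?vx) (pd_y dm dp ?vx)"
    "C1_on dm dp ?vy (pd_x ?vy) (pd_y dm dp ?vy)"
    using assms(7) unfolding C2_band_def by (auto intro: C1_band_C1_on)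
  have W: "C1_on dm dp w ?ux ?uy"
    using U(1) unfolding C1_on_def dx_on_def dy_on_def w_def
    by (auto intro!: continuous_intros derivative_eq_intros)
  have mixed: "pd_y dm dp ?vx p = pd_x ?vy p" if "p \<in> ?B" for p
    using mixed_partials_eq[OF assms(2) C1_onD(1,2)[OF V(1)] C1_onD(2)[OF V(2)] C1_onD(1)[OF V(3)]
        C1_onD(5)[OF V(2)] C1_onD(4)[OF V(3)] that] .
  have V3: "C1_on dm dp ?vy (pd_y dm dp ?vx) (pd_y dm dp ?vy)"
    using V(3) mixed unfolding C1_on_def dx_on_def by (auto cong: continuous_on_cong)
  have origin: "(0, dm) \<in> ?B" using assms(2) by simp
  interpret travelling_wave_pair L dm dp \<beta> w ?ux ?uy "pd_x ?ux" "pd_y dm dp ?ux" "pd_x ?uy" "pd_y dm dp ?uy"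
    v ?vx ?vy "pd_x ?vx" "pd_y dm dp ?vx" "pd_y dm dp ?vy"
  proof
    show "x_periodic L dm dp w" using assms(4) by (simp add: x_periodic_def w_def)
    show "w p * (pd_x ?vx p + pd_y dm dp ?vy p) + (\<beta> - (pd_x ?ux p + pd_y dm dp ?uy p)) * v p = 0"
      if "p \<in> ?B" for p
      using tw(4)[OF that] by (simp add: w_def)
  qed (use assms U V(1,2) V3 W tw(1) tw(2,3)[OF origin] in auto)
  obtain p1 where p1: "p1 \<in> ?B" "v p1 \<noteq> 0"
    using assms(9) by (auto simp: shear_flow_def)
  have range: "u ` ?B = {band_min dm dp u..band_max dm dp u}" and "band_min dm dp u \<le> band_max dm dp u"
    using band_range[OF assms(1,2,4) C1_onD(3)[OF U(1)]] by auto
  have u_mem: "band_min dm dp u \<le> u p" "u p \<le> band_max dm dp u" if "p \<in> ?B" for p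
    using range that by auto
  have infl: "\<beta> - (pd_x ?ux p + pd_y dm dp ?uy p) \<noteq> 0"
    if "{p \<in> ?B. \<beta> - laplacian dm dp u p = 0} \<inter> {p \<in> ?B. u p = c} = {}" "p \<in> ?B" "w p = 0" for p
    using that by (auto simp: laplacian_def w_def)
  show ?thesis
  proof (intro conjI impI)
    assume \<beta>: "\<beta> > 0"
    show "{p \<in> ?B. \<beta> - laplacian dm dp u p = 0} \<inter> {p \<in> ?B. u p = c} \<noteq> {} \<or>
            {p \<in> ?B. gradient dm dp u p = 0} \<inter> {p \<in> ?B. u p = c} \<noteq> {} \<or>
            c \<in> {band_max dm dp u, band_min dm dp u} \<or>
            (c \<notin> u ` ?B \<and> c \<in> {c_beta_plus dm dp \<beta> u..<band_min dm dp u})"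
    proof (rule ccontr)
      assume "\<not> ?thesis"
      then have noinfl: "{p \<in> ?B. \<beta> - laplacian dm dp u p = 0} \<inter> {p \<in> ?B. u p = c} = {}"
        and nocrit: "{p \<in> ?B. gradient dm dp u p = 0} \<inter> {p \<in> ?B. u p = c} = {}"
        and c: "c \<noteq> band_max dm dp u" "c \<noteq> band_min dm dp u"
        and out: "c \<notin> u ` ?B \<Longrightarrow> c \<ge> c_beta_plus dm dp \<beta> u \<Longrightarrow> c \<ge> band_min dm dp u"
        by auto
      have "v p1 = 0"
      proof (cases "c > band_min dm dp u")
        \<comment> \<open>This includes \<open>c\<close> above the maximum of \<open>u\<close>. In
          all these cases \<open>w\<close> is negative at a minimum point of
          \<open>u\<close>.\<close>
        case True
        have "band_min dm dp u \<in> u ` ?B" using range \<open>band_min dm dp u \<le> band_max dm dp u\<close> by simp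
        then obtain p0 where p0: "p0 \<in> ?B" "w p0 < 0" using True by (auto simp: w_def)
        show ?thesis
        proof (rule negative_value_rigidity[OF \<beta> infl[OF noinfl] _ p0 p1(1)])
          show "?ux p \<noteq> 0 \<or> ?uy p \<noteq> 0" if "p \<in> ?B" "w p = 0" for p
            using that nocrit by (auto simp: gradient_def w_def zero_prod_def)
        qed
      next
        case False
        \<comment> \<open>Now \<open>w\<close> is positive on the band, with extreme values
          \<open>band_min dm dp u - c\<close> and \<open>band_max dm dp u - c\<close>.\<close>
        then have lt: "c < band_min dm dp u" using c by simp
        then have "c \<notin> u ` ?B" using range by auto
        then have "c < c_beta_plus dm dp \<beta> u" using out lt by fastforce
        then have "\<beta> * (dp - dm)\<^sup>2 / (2 * pi\<^sup>2) + (dp - dm)\<^sup>2 / (2 * pi\<^sup>2) *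
            sqrt (\<beta>\<^sup>2 + 4 * pi\<^sup>2 * \<beta> / (dp - dm)\<^sup>2 * (band_max dm dp u - band_min dm dp u))
            < band_min dm dp u - c"
          unfolding c_beta_plus_def by linarith
        note m = c_beta_plus_quadratic[OF _ \<beta> _ this]
        show ?thesis
        proof (rule positive_rigidity[OF _ _ _ _ p1(1)])
          show "band_min dm dp u - c > 0" using lt by simp
          show "\<beta> * (band_max dm dp u - c) < ((band_min dm dp u - c) * (pi / (dp - dm)))\<^sup>2"
            using m(2) assms(2) \<open>band_min dm dp u \<le> band_max dm dp u\<close> by simp
        qed (use u_mem in \<open>auto simp: w_def\<close>)
      qed
      with p1(2) show False by simp
    qed
  next
    assume \<beta>: "\<beta> = 0"
    show "{p \<in> ?B. laplacian dm dp u p = 0} \<inter> {p \<in> ?B. u p = c} \<noteq> {}"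
    proof
      assume "{p \<in> ?B. laplacian dm dp u p = 0} \<inter> {p \<in> ?B. u p = c} = {}"
      then have "{p \<in> ?B. \<beta> - laplacian dm dp u p = 0} \<inter> {p \<in> ?B. u p = c} = {}" by (simp add: \<beta>)
      then obtain C where C: "C \<ge> 0" "\<And>p. p \<in> ?B \<Longrightarrow> \<bar>v p\<bar> \<le> C * \<bar>w p\<bar>"
        using v_le_w[OF infl] by metis
      \<comment> \<open>For \<open>\<beta> = 0\<close> the vorticity equation is linear in
        \<open>w\<close> for fixed \<open>v\<close>, so \<open>- w\<close> satisfies it too and the
        estimate on its negative set covers \<open>{w > 0}\<close>.\<close>
      interpret neg: vorticity_pair L dm dp \<beta> "\<lambda>p. - w p" "\<lambda>p. - ?ux p" "\<lambda>p. - ?uy p"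
        "\<lambda>p. - pd_x ?ux p" "\<lambda>p. - pd_y dm dp ?ux p" "\<lambda>p. - pd_x ?uy p" "\<lambda>p. - pd_y dm dp ?uy p"
        v ?vx ?vy "pd_x ?vx" "pd_y dm dp ?vx" "pd_y dm dp ?vy"
      proof
        show "C1_on dm dp (\<lambda>p. - w p) (\<lambda>p. - ?ux p) (\<lambda>p. - ?uy p)"
          "C1_on dm dp (\<lambda>p. - ?ux p) (\<lambda>p. - pd_x ?ux p) (\<lambda>p. - pd_y dm dp ?ux p)"
          "C1_on dm dp (\<lambda>p. - ?uy p) (\<lambda>p. - pd_x ?uy p) (\<lambda>p. - pd_y dm dp ?uy p)"
          by (rule C1_on_minus, fact W U)+
        show "x_periodic L dm dp (\<lambda>p. - w p)" using wper by (simp add: x_periodic_def)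
        show "- w p * (pd_x ?vx p + pd_y dm dp ?vy p)
            + (\<beta> - (- pd_x ?ux p + - pd_y dm dp ?uy p)) * v p = 0" if "p \<in> ?B" for p
          using vorticity[OF that] by (simp add: \<beta> algebra_simps)
      qed (use assms v v_bdry vper in auto)
      have "w p * ?vx p = v p * ?ux p \<and> w p * ?vy p = v p * ?uy p" if p: "p \<in> ?B" for p
      proof -
        consider "w p < 0" | "w p > 0" | "w p = 0" by linarith
        then show ?thesis
        proof cases
          case 1
          then show ?thesis using negative_region(1,2)[OF C p] by simp
        next
          case 2
          have C': "\<bar>v p\<bar> \<le> C * \<bar>- w p\<bar>" if "p \<in> ?B" for p using C(2)[OF that] by simp
          show ?thesis using neg.negative_region(1,2)[OF C(1) C' p] 2 by simp
        next
          \<comment> \<open>Here \<open>v\<close> vanishes together with \<open>w\<close> by the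
            bound \<open>\<bar>v\<bar> \<le> C * \<bar>w\<bar>\<close>, so both sides of each
            identity are zero.\<close>
          case 3
          then show ?thesis using C(2)[OF p] by simp
        qed
      qed
      then have "v p1 = 0" using proportional_rigidity p1(1) by blast
      with p1(2) show False by simp
    qed
  qed
qed

end
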